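(* Let $\Omega\subset\mathbb{R}^n$ be open and bounded and $\mu$ a finite positive Borel measure on $\Omega$. Let $A,B\subset\mathcal{G}_1$ be two separable algebras that separate points from closed sets, and let $\Gamma=A\cap B$. Let $(v_j)_j\subset L^1(\Omega,\mu,\mathbb{R}^d)$ be a sequence such that $$v_j\xrightarrow{Y(\mu,A)}(\nu_x,\lambda_\nu,\nu_x^\infty)\quad\text{and}\quad v_j\xrightarrow{Y(\mu,B)}(\eta_x,\lambda_\eta,\eta_x^\infty)$$ (in this situation $\lambda_\nu=\lambda_\eta=:\lambda$). Write $$\nu_x^\infty=P^\nu_{w}\,d(\gamma^\nu)_x^\infty(w)\quad\text{and}\quad \eta_x^\infty=P^\eta_{w}\,d(\gamma^\eta)_x^\infty(w),$$ where $(\gamma^\nu)_x^\infty$ and $(\gamma^\eta)_x^\infty$ are the projections of $\nu_x^\infty$ and $\eta_x^\infty$ onto the compactification generated by $\Gamma$. Then $$(\gamma^\nu)_x^\infty=(\gamma^\eta)_x^\infty\quad\text{for }\lambda\text{-a.e. }x.$$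
   Context: $\mathbb{B}^d$ is the open unit ball of $\mathbb{R}^d$ and $BC(\mathbb{B}^d)$ the bounded continuous real functions on it with the sup norm. $\mathcal{G}_1$ is the space of $f\in C(\mathbb{R}^d)$ with $\sup_z|f(z)|/(1+|z|)<\infty$. The map $Tf(\hat z)=(1-|\hat z|)f\big(\frac{\hat z}{1-|\hat z|}\big)$, $\hat z\in\mathbb{B}^d$, is a bijection of $\mathcal{G}_1$ onto $BC(\mathbb{B}^d)$; $\mathcal{G}_1$ is normed by $\|Tf\|_\infty$ and carries the product $T^{-1}(Tf\cdot Tg)$. "Algebra" in $\mathcal{G}_1$ refers to this product (i.e. $T(A)$ is a subalgebra of $BC(\mathbb{B}^d)$), and "separable" to this norm. $A$ separates points from closed sets if for each closed $C\subset\mathbb{B}^d$ and each $z\in\mathbb{B}^d\setminus C$ there is $g\in T(A)$ with $g(z)\notin\overline{g(C)}$. For $A\subset\mathcal{G}_1$ let $K_A$ be the closure of the image of $\mathbb{B}^d$ under $z\mapsto(g(z))_{g\in T(A)}\in\prod_{g\in T(A)}[\inf g,\sup g]$ (product topology). If $A$ separates points from closed sets, $K_A$ is a compactification of $\mathbb{B}^d$ and $\partial K_A=K_A\setminus\mathbb{B}^d$. The compact space $K_\Gamma$ is defined in the same way (even if $\Gamma$ does not separate points from closed sets) and is what is meant by the compactification generated by $\Gamma$. Since $\Gamma\subset A$, forgetting coordinates gives a continuous surjection $K_A\to K_\Gamma$, and similarly for $B$; projections of measures are push-forwards under these maps, and $P^\nu_w$, $P^\eta_w$ are the probability measures on the fibres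 over $w$ obtained by disintegrating $\nu_x^\infty$, $\eta_x^\infty$ with respect to these maps. If $f\in C(\mathbb{R}^d)$ and $Tf$ extends continuously to $K_A$, let $f^\infty$ be the restriction of the extension to $\partial K_A$. A norm-bounded sequence $(v_j)$ in $L^1(\Omega,\mu,\mathbb{R}^d)$ satisfies $v_j\xrightarrow{Y(\mu,A)}(\nu_x,\lambda,\nu_x^\infty)$, where $(\nu_x)_{x\in\Omega}$ is a $\mu$-measurable family of probability measures on $\mathbb{R}^d$ with $\int_\Omega\int|z|\,d\nu_x\,d\mu<\infty$, $\lambda$ is a finite positive Borel measure on $\overline\Omega$, and $(\nu_x^\infty)_{x\in\overline\Omega}$ is a $\lambda$-measurable family of probability measures on $\partial K_A$, if for all $\phi\in C(\overline\Omega)$ and all $f\in C(\mathbb{R}^d)$ such that $Tf$ extends continuously to $K_A$ $$\int_\Omega\phi f(v_j)\,d\mu\to\int_\Omega\phi\int_{\mathbb{R}^d} f\,d\nu_x\,d\mu+\int_{\overline\Omega}\phi\int_{\partial K_A}f^\infty\, d\nu_x^\infty\,d\lambda.$$ *)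

theory Defs
  imports "HOL-Probability.Probability"
begin

definition G1 :: "('d::euclidean_space \<Rightarrow> real) set" where
  "G1 = {f. continuous_on UNIV f \<and> (\<exists>C. \<forall>z. \<bar>f z\<bar> \<le> C * (1 + norm z))}"

text \<open>Functions on the open unit ball are represented as extensional functions, so that
  \<open>T\<close> is injective and its values are exactly determined on the ball.\<close>

definition T :: "('d::euclidean_space \<Rightarrow> real) \<Rightarrow> 'd \<Rightarrow> real" where
  "T f = (\<lambda>z\<in>ball 0 1. (1 - norm z) * f (z /\<^sub>R (1 - norm z)))"

definition T_inv :: "('d::euclidean_space \<Rightarrow> real) \<Rightarrow> 'd \<Rightarrow> real" where
  "T_inv g = (\<lambda>z. (1 + norm z) * g (z /\<^sub>R (1 + norm z)))"

definition G1_norm :: "('d::euclidean_space \<Rightarrow> real) \<Rightarrow> real" where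
  "G1_norm f = (SUP z\<in>ball 0 1. \<bar>T f z\<bar>)"

definition G1_mult :: "('d::euclidean_space \<Rightarrow> real) \<Rightarrow> ('d \<Rightarrow> real) \<Rightarrow> 'd \<Rightarrow> real" where
  "G1_mult f g = T_inv (\<lambda>z. T f z * T g z)"

text \<open>The unit of \<open>G1\<close>, which is \<open>\<lambda>z. 1 + norm z\<close>, is not required to lie in a subalgebra.\<close>

definition G1_subalgebra :: "('d::euclidean_space \<Rightarrow> real) set \<Rightarrow> bool" where
  "G1_subalgebra A \<longleftrightarrow> A \<subseteq> G1 \<and> (\<lambda>z. 0) \<in> A \<and>
     (\<forall>f\<in>A. \<forall>g\<in>A. (\<lambda>z. f z + g z) \<in> A) \<and>
     (\<forall>c. \<forall>f\<in>A. (\<lambda>z. c * f z) \<in> A) \<and>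
     (\<forall>f\<in>A. \<forall>g\<in>A. G1_mult f g \<in> A)"

definition G1_separable :: "('d::euclidean_space \<Rightarrow> real) set \<Rightarrow> bool" where
  "G1_separable A \<longleftrightarrow> (\<exists>D\<subseteq>A. countable D \<and>
     (\<forall>f\<in>A. \<forall>\<epsilon>>0. \<exists>g\<in>D. G1_norm (\<lambda>z. f z - g z) < \<epsilon>))"

definition separates_points_closed :: "('d::euclidean_space \<Rightarrow> real) set \<Rightarrow> bool" where
  "separates_points_closed A \<longleftrightarrow>
     (\<forall>C z. closedin (top_of_set (ball 0 1)) C \<and> z \<in> ball 0 1 - C \<longrightarrow>
        (\<exists>g\<in>T ` A. g z \<notin> closure (g ` C)))"

definition cube :: "('d::euclidean_space \<Rightarrow> real) set \<Rightarrow> (('d \<Rightarrow> real) \<Rightarrow> real) topology" where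
  "cube A = product_topology
     (\<lambda>g. top_of_set {(INF z\<in>ball 0 1. g z)..(SUP z\<in>ball 0 1. g z)}) (T ` A)"

definition emb :: "('d::euclidean_space \<Rightarrow> real) set \<Rightarrow> 'd \<Rightarrow> ('d \<Rightarrow> real) \<Rightarrow> real" where
  "emb A z = (\<lambda>g\<in>T ` A. g z)"

definition K :: "('d::euclidean_space \<Rightarrow> real) set \<Rightarrow> (('d \<Rightarrow> real) \<Rightarrow> real) topology" where
  "K A = subtopology (cube A) (cube A closure_of (emb A ` ball 0 1))"

definition bdry :: "('d::euclidean_space \<Rightarrow> real) set \<Rightarrow> (('d \<Rightarrow> real) \<Rightarrow> real) topology" where
  "bdry A = subtopology (K A) (topspace (K A) - emb A ` ball 0 1)"

definition forget :: "('d::euclidean_space \<Rightarrow> real) set \<Rightarrow> (('d \<Rightarrow> real) \<Rightarrow> real) \<Rightarrow> ('d \<Rightarrow> real) \<Rightarrow> real" where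
  "forget \<Gamma> p = restrict p (T ` \<Gamma>)"

definition borel_of :: "'a topology \<Rightarrow> 'a measure" where
  "borel_of X = sigma (topspace X) {U. openin X U}"

definition proj_K :: "('d::euclidean_space \<Rightarrow> real) set \<Rightarrow> (('d \<Rightarrow> real) \<Rightarrow> real) measure
    \<Rightarrow> (('d \<Rightarrow> real) \<Rightarrow> real) measure" where
  "proj_K \<Gamma> M = distr M (borel_of (K \<Gamma>)) (forget \<Gamma>)"

text \<open>\<open>F\<close> is unique on the topological space \<open>K A\<close>, since the image of the ball is dense;
  its restriction to the boundary is the function written \<open>f\<close> with superscript infinity.\<close>

definition extension_to_K ::
    "('d::euclidean_space \<Rightarrow> real) set \<Rightarrow> ('d \<Rightarrow> real) \<Rightarrow> ((('d \<Rightarrow> real) \<Rightarrow> real) \<Rightarrow> real) \<Rightarrow> bool" where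
  "extension_to_K A f F \<longleftrightarrow>
     continuous_map (K A) euclideanreal F \<and> (\<forall>z\<in>ball 0 1. F (emb A z) = T f z)"

definition borel_measure_on :: "'a::topological_space set \<Rightarrow> 'a measure \<Rightarrow> bool" where
  "borel_measure_on S M \<longleftrightarrow> sets M = sets (restrict_space borel S) \<and> finite_measure M"

text \<open>Families of measures are measurable with respect to the completed base measure, hence the
  outer integrals on the right-hand side are also taken with respect to the completion (the Bochner
  integral of a function that is not measurable is \<open>0\<close> by convention).\<close>

definition young_converges ::
    "'n::euclidean_space set \<Rightarrow> 'n measure \<Rightarrow> ('d::euclidean_space \<Rightarrow> real) set \<Rightarrow> (nat \<Rightarrow> 'n \<Rightarrow> 'd)
     \<Rightarrow> ('n \<Rightarrow> 'd measure) \<Rightarrow> 'n measure \<Rightarrow> ('n \<Rightarrow> (('d \<Rightarrow> real) \<Rightarrow> real) measure) \<Rightarrow> bool" where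
  "young_converges \<Omega> \<mu> A v \<nu> \<Lambda> \<nu>i \<longleftrightarrow>
     (\<forall>j. integrable \<mu> (v j)) \<and>
     (\<exists>C. \<forall>j. (\<integral>x. norm (v j x) \<partial>\<mu>) \<le> C) \<and>
     \<nu> \<in> completion \<mu> \<rightarrow>\<^sub>M prob_algebra borel \<and>
     (\<integral>\<^sup>+x. (\<integral>\<^sup>+z. ennreal (norm z) \<partial>\<nu> x) \<partial>completion \<mu>) < \<infinity> \<and>
     borel_measure_on (closure \<Omega>) \<Lambda> \<and>
     \<nu>i \<in> completion \<Lambda> \<rightarrow>\<^sub>M prob_algebra (borel_of (bdry A)) \<and>
     (\<forall>\<phi> f F. continuous_on (closure \<Omega>) \<phi> \<and> continuous_on UNIV f \<and> extension_to_K A f F \<longrightarrow>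
        (\<lambda>j. \<integral>x. \<phi> x * f (v j x) \<partial>\<mu>) \<longlonglongrightarrow>
          (\<integral>x. \<phi> x * (\<integral>z. f z \<partial>\<nu> x) \<partial>completion \<mu>) +
          (\<integral>x. \<phi> x * (\<integral>p. F p \<partial>\<nu>i x) \<partial>completion \<Lambda>))"

end

theory Submission
  imports Defs
begin

text \<open>Since the ball is open in \<open>K A\<close> and in \<open>K B\<close>, a compactly supported \<open>f\<close> extends by zero and its
  limit only sees \<open>\<nu>\<close>, respectively \<open>\<eta>\<close>. Truncation and dominated convergence then give equal
  oscillation terms for every \<open>f\<close> in \<open>G1\<close>, so the concentration terms agree too whenever \<open>f\<close> extends to
  both compactifications. The function \<open>1 + |z|\<close> yields equality of the concentration measures, and the
  elements of \<open>\<Gamma>\<close> (restricted to a countable dense set to keep one null set) yield equality of the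
  integrals of all coordinate functions on \<open>K \<Gamma>\<close>. These form an algebra separating points, so
  Stone--Weierstrass identifies the two projections.\<close>

section \<open>Measures determined by continuous functions\<close>

text \<open>The two limits live on unrelated boundaries and share only the integrals over
  \<open>\<mu>\<close>, and each is a sum of an oscillation and a concentration part. Separating the
  parts takes test functions that extend to both compactifications, while \<open>\<Gamma>\<close>
  need contain neither the unit nor any nonzero compactly supported function. They are nevertheless
  admissible, because the extension notion asks for continuity on the compactification and not for
  membership in the algebra. A second obstacle is that \<open>K \<Gamma>\<close> is a topology
  inside a product with possibly uncountably many factors, where uniqueness of measures on metric
  spaces does not apply directly; a countable dense set of coordinates moves the comparison to
  \<open>nat \<Rightarrow> real\<close>. A third is that the families are measurable only for
  completed base measures, so their integrals are compared through Borel versions.\<close>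

lemma measure_eqI_continuous:
  fixes M N :: "'a::metric_space measure"
  assumes sets: "sets M = sets borel" "sets N = sets borel"
    and fin: "finite_measure M" "finite_measure N"
    and eq: "\<And>f::'a \<Rightarrow> real. continuous_on UNIV f \<Longrightarrow> bounded (range f) \<Longrightarrow> integral\<^sup>L M f = integral\<^sup>L N f"
  shows "M = N"
proof -
  have space: "space M = UNIV" "space N = UNIV"
    using sets[THEN sets_eq_imp_space_eq] by simp_all
  have closed_eq: "emeasure M C = emeasure N C" if C: "closed C" for C
  proof (cases "C = {}")
    case False
    \<comment> \<open>Lipschitz cutoffs that are 1 on \<open>C\<close> and decrease to its indicator
      as the slope \<open>n\<close> grows. The empty set is split off because \<open>infdist\<close>
      to it is 0 by convention, which would make every \<open>f n\<close> constantly 1.\<close>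
    define f where "f n x = max 0 (1 - real n * infdist x C)" for n x
    have cont: "continuous_on UNIV (f n)" for n
      unfolding f_def by (intro continuous_intros)
    have range: "0 \<le> f n x" "f n x \<le> 1" for n x
      by (auto simp: f_def infdist_nonneg)
    have lim: "(\<lambda>n. f n x) \<longlonglongrightarrow> indicator C x" for x
    proof (cases "x \<in> C")
      case True
      then show ?thesis by (simp add: f_def)
    next
      case x: False
      then have pos: "infdist x C > 0"
        using C False infdist_pos_not_in_closed by blast
      obtain m where m: "1 / infdist x C < real m"
        using reals_Archimedean2 by blast
      have "f n x = 0" if "n \<ge> m" for n
      proof -
        have "1 < real m * infdist x C"
          using m pos by (simp add: divide_less_eq)
        also have "\<dots> \<le> real n * infdist x C"
          using that pos by (intro mult_right_mono) auto
        finally have "1 < real n * infdist x C" .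
        then show ?thesis by (simp add: f_def)
      qed
      then have "\<forall>\<^sub>F n in sequentially. f n x = indicator C x"
        using x by (intro eventually_sequentiallyI[of m]) simp
      then show ?thesis
        by (rule tendsto_eventually)
    qed
    have "(\<lambda>n. integral\<^sup>L P (f n)) \<longlonglongrightarrow> measure P C"
      if P: "sets P = sets borel" "finite_measure P" for P
    proof -
      interpret finite_measure P by fact
      have [measurable]: "f n \<in> borel_measurable P" for n
        unfolding measurable_cong_sets[OF P(1) refl] by (rule borel_measurable_continuous_onI[OF cont])
      have [measurable]: "C \<in> sets P" using P C by simp
      have "(\<lambda>n. integral\<^sup>L P (f n)) \<longlonglongrightarrow> integral\<^sup>L P (indicator C :: _ \<Rightarrow> real)"
        by (rule integral_dominated_convergence[where w="\<lambda>_. 1"]) (use lim range in \<open>auto simp: finite_measure_axioms\<close>)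
      then show ?thesis by simp
    qed
    note this[OF sets(1) fin(1)] this[OF sets(2) fin(2)]
    moreover have "integral\<^sup>L M (f n) = integral\<^sup>L N (f n)" for n
      using range by (intro eq cont) (auto simp: bounded_iff intro!: exI[of _ 1])
    ultimately have "measure M C = measure N C"
      by (simp add: LIMSEQ_unique)
    then show ?thesis
      using fin by (simp add: finite_measure.emeasure_eq_measure)
  qed simp
  show ?thesis
  proof (rule measure_eqI_generator_eq[where E="Collect closed" and \<Omega>=UNIV and A="\<lambda>_. UNIV"])
    show "Int_stable (Collect closed :: 'a set set)"
      by (auto simp: Int_stable_def)
    show "sets M = sigma_sets UNIV (Collect closed)" "sets N = sigma_sets UNIV (Collect closed)"
      using sets by (simp_all add: borel_eq_closed)
    show "emeasure M UNIV \<noteq> \<infinity>"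
      using fin(1) by (simp add: finite_measure.emeasure_eq_measure)
  qed (use closed_eq in auto)
qed

text \<open>Both measures are pushed forward along the inclusion and compared on the whole space. A
  closed \<open>S\<close> is Borel, so every measurable set of \<open>M\<close> is Borel in the
  large space and keeps its mass; the test functions can thus be global.\<close>

lemma borel_measure_on_eqI:
  fixes M N :: "'a::metric_space measure"
  assumes S: "closed S" and M: "borel_measure_on S M" and N: "borel_measure_on S N"
    and eq: "\<And>f::'a \<Rightarrow> real. continuous_on UNIV f \<Longrightarrow> bounded (range f) \<Longrightarrow> integral\<^sup>L M f = integral\<^sup>L N f"
  shows "M = N"
proof -
  have "distr M borel id = distr N borel id"
  proof (rule measure_eqI_continuous)
    have id [measurable]: "id \<in> borel_measurable M" "id \<in> borel_measurable N"
      using M N unfolding borel_measure_on_def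
      by (auto simp: measurable_restrict_space1 cong: measurable_cong_sets)
    show "finite_measure (distr M borel id)" "finite_measure (distr N borel id)"
      using M N by (auto simp: borel_measure_on_def intro!: finite_measure.finite_measure_distr)
    fix f :: "'a \<Rightarrow> real"
    assume f: "continuous_on UNIV f" "bounded (range f)"
    from f have [measurable]: "f \<in> borel_measurable borel"
      using borel_measurable_continuous_onI by blast
    show "integral\<^sup>L (distr M borel id) f = integral\<^sup>L (distr N borel id) f"
      using eq[OF f] by (simp add: integral_distr)
  qed auto
  moreover have "emeasure P X = emeasure (distr P borel id) X"
    if P: "borel_measure_on S P" and X: "X \<in> sets P" for P X
  proof -
    have "X \<subseteq> S" "X \<in> sets borel"
      using P X S by (auto simp: borel_measure_on_def sets_restrict_space)
    moreover have "space P = S"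
      using P by (auto simp: borel_measure_on_def space_restrict_space dest: sets_eq_imp_space_eq)
    moreover have "id \<in> borel_measurable P"
      using P unfolding borel_measure_on_def
      by (auto simp: measurable_restrict_space1 cong: measurable_cong_sets)
    ultimately show ?thesis
      by (auto simp: emeasure_distr Int_absorb2)
  qed
  ultimately show ?thesis
    using M N by (intro measure_eqI) (auto simp: borel_measure_on_def)
qed

text \<open>Adding the common bound \<open>c\<close> turns \<open>g\<close> and \<open>h\<close>
  into nonnegative densities of finite measures. The extra term, \<open>c\<close> times the integral
  of \<open>\<phi>\<close>, is the same for both, so uniqueness of measures and then of densities
  applies.\<close>

lemma AE_eq_if_continuous_moments_eq:
  fixes M :: "'a::metric_space measure" and g h :: "'a \<Rightarrow> real"
  assumes S: "closed S" and M: "borel_measure_on S M"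
    and g: "g \<in> borel_measurable (completion M)" and h: "h \<in> borel_measurable (completion M)"
    and bound: "\<And>x. x \<in> S \<Longrightarrow> \<bar>g x\<bar> \<le> c" "\<And>x. x \<in> S \<Longrightarrow> \<bar>h x\<bar> \<le> c"
    and eq: "\<And>\<phi>. continuous_on UNIV \<phi> \<Longrightarrow> bounded (range \<phi>) \<Longrightarrow>
       (\<integral>x. \<phi> x * g x \<partial>completion M) = (\<integral>x. \<phi> x * h x \<partial>completion M)"
  shows "AE x in M. g x = h x"
proof -
  interpret finite_measure M using M by (simp add: borel_measure_on_def)
  have space: "space M = S"
    using M by (auto simp: borel_measure_on_def space_restrict_space dest: sets_eq_imp_space_eq)
  have cont_meas: "\<phi> \<in> borel_measurable M" if "continuous_on UNIV \<phi>" for \<phi> :: "'a \<Rightarrow> real"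
    using M borel_measurable_continuous_onI[OF that] unfolding borel_measure_on_def
    by (auto simp: measurable_restrict_space1 cong: measurable_cong_sets)
  \<comment> \<open>\<open>g\<close> and \<open>h\<close> are measurable only for the completion,
    whereas densities are taken over \<open>M\<close>; Borel versions that agree almost everywhere
    bridge the gap.\<close>
  obtain g' where g'[measurable]: "g' \<in> borel_measurable M" and gg': "AE x in M. g x = g' x"
    using completion_ex_borel_measurable_real[OF g] by blast
  obtain h' where h'[measurable]: "h' \<in> borel_measurable M" and hh': "AE x in M. h x = h' x"
    using completion_ex_borel_measurable_real[OF h] by blast
  have bound': "AE x in M. \<bar>g' x\<bar> \<le> c" "AE x in M. \<bar>h' x\<bar> \<le> c"
    subgoal using gg' AE_space by eventually_elim (use bound(1) space in metis)
    subgoal using hh' AE_space by eventually_elim (use bound(2) space in metis)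
    done
  have dens: "borel_measure_on S (density M (\<lambda>x. ennreal (k x + c)))
      \<and> (\<forall>\<phi>. continuous_on UNIV \<phi> \<longrightarrow> bounded (range \<phi>) \<longrightarrow>
          integral\<^sup>L (density M (\<lambda>x. ennreal (k x + c))) \<phi>
            = (\<integral>x. \<phi> x * k x \<partial>M) + c * (\<integral>x. \<phi> x \<partial>M))"
    if k[measurable]: "k \<in> borel_measurable M" and kb: "AE x in M. \<bar>k x\<bar> \<le> c" for k
  proof (intro conjI allI impI)
    have "(\<integral>\<^sup>+x. ennreal (k x + c) \<partial>M) \<le> (\<integral>\<^sup>+x. ennreal (c + c) \<partial>M)"
      by (rule nn_integral_mono_AE) (use kb in \<open>eventually_elim, auto intro!: ennreal_leI\<close>)
    also have "\<dots> < \<infinity>"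
      by (simp add: ennreal_mult_less_top ennreal_mult_eq_top_iff less_top[symmetric])
    finally have "emeasure (density M (\<lambda>x. ennreal (k x + c))) (space M) \<noteq> \<infinity>"
      by (simp add: emeasure_density cong: nn_integral_cong)
    then show "borel_measure_on S (density M (\<lambda>x. ennreal (k x + c)))"
      using M unfolding borel_measure_on_def
      by (auto intro!: finite_measureI)
    fix \<phi> :: "'a \<Rightarrow> real" assume \<phi>: "continuous_on UNIV \<phi>" "bounded (range \<phi>)"
    have [measurable]: "\<phi> \<in> borel_measurable M" using cont_meas \<phi> by blast
    obtain b where b: "\<bar>\<phi> x\<bar> \<le> b" for x
      using \<phi>(2) by (auto simp: bounded_iff)
    have int\<phi>: "integrable M \<phi>"
      by (rule integrable_const_bound[where B=b]) (use b in auto)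
    have int: "integrable M (\<lambda>x. \<phi> x * k x)"
    proof (rule integrable_const_bound[where B="b * c"])
      show "AE x in M. norm (\<phi> x * k x) \<le> b * c"
        using kb by eventually_elim
          (use b in \<open>auto simp: abs_mult intro!: mult_mono order_trans[OF abs_ge_zero b]\<close>)
    qed simp
    have "integral\<^sup>L (density M (\<lambda>x. ennreal (k x + c))) \<phi> = (\<integral>x. (k x + c) * \<phi> x \<partial>M)"
      by (subst integral_density) (use kb in \<open>auto\<close>)
    also have "\<dots> = (\<integral>x. \<phi> x * k x + c * \<phi> x \<partial>M)"
      by (simp add: algebra_simps)
    also have "\<dots> = (\<integral>x. \<phi> x * k x \<partial>M) + c * (\<integral>x. \<phi> x \<partial>M)"
      using int int\<phi> by simp
    finally show "integral\<^sup>L (density M (\<lambda>x. ennreal (k x + c))) \<phi>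
        = (\<integral>x. \<phi> x * k x \<partial>M) + c * (\<integral>x. \<phi> x \<partial>M)" .
  qed
  have moments: "(\<integral>x. \<phi> x * g' x \<partial>M) = (\<integral>x. \<phi> x * h' x \<partial>M)"
    if \<phi>: "continuous_on UNIV \<phi>" "bounded (range \<phi>)" for \<phi>
  proof -
    have [measurable]: "\<phi> \<in> borel_measurable M" using cont_meas \<phi> by blast
    have *: "(\<integral>x. \<phi> x * k x \<partial>completion M) = (\<integral>x. \<phi> x * k' x \<partial>M)"
      if "k \<in> borel_measurable (completion M)" "AE x in M. k x = k' x"
        and [measurable]: "k' \<in> borel_measurable M" for k k'
    proof -
      have "(\<integral>x. \<phi> x * k x \<partial>completion M) = (\<integral>x. \<phi> x * k' x \<partial>completion M)"
      proof (rule integral_cong_AE)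
        show "(\<lambda>x. \<phi> x * k x) \<in> borel_measurable (completion M)"
          by (rule borel_measurable_times[OF measurable_completion that(1)]) measurable
        show "(\<lambda>x. \<phi> x * k' x) \<in> borel_measurable (completion M)"
          by (rule measurable_completion) measurable
        show "AE x in completion M. \<phi> x * k x = \<phi> x * k' x"
          using that(2) by (auto simp: AE_completion_iff)
      qed
      also have "\<dots> = (\<integral>x. \<phi> x * k' x \<partial>M)"
        by (rule integral_completion) simp
      finally show ?thesis .
    qed
    show ?thesis
      using eq[OF \<phi>] *[OF g gg' g'] *[OF h hh' h'] by simp
  qed
  have "density M (\<lambda>x. ennreal (g' x + c)) = density M (\<lambda>x. ennreal (h' x + c))"
    using dens[OF g' bound'(1)] dens[OF h' bound'(2)] moments
    by (intro borel_measure_on_eqI[OF S]) auto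
  then have "AE x in M. ennreal (g' x + c) = ennreal (h' x + c)"
    by (subst (asm) density_unique_iff) auto
  \<comment> \<open>\<open>ennreal\<close> sends negative reals to 0, so it can be cancelled only
    because \<open>c\<close> bounds both functions in absolute value.\<close>
  with gg' hh' bound' show ?thesis
    by eventually_elim (auto simp: abs_le_iff)
qed

section \<open>The compactification\<close>

lemma T_apply: "z \<in> ball 0 1 \<Longrightarrow> T f z = (1 - norm z) * f (z /\<^sub>R (1 - norm z))"
  by (simp add: T_def)

lemma T_one_plus_norm: "z \<in> ball 0 1 \<Longrightarrow> T (\<lambda>z. 1 + norm z) z = 1"
  by (simp add: T_apply field_simps)

text \<open>The substitution w = z/(1-|z|) is undone by w/(1+|w|), and the weights satisfy
  (1-|z|)(1+|w|) = 1; hence \<open>T\<close> undoes \<open>T_inv\<close> on the ball.\<close>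

lemma T_G1_mult:
  assumes z: "z \<in> ball 0 1" shows "T (G1_mult f g) z = T f z * T g z"
proof -
  define w where "w = z /\<^sub>R (1 - norm z)"
  have nz: "norm z < 1" using z by simp
  have w: "1 + norm w = 1 / (1 - norm z)"
    using nz by (simp add: w_def field_simps)
  have "w /\<^sub>R (1 + norm w) = z"
    using nz unfolding w by (simp add: w_def)
  then show ?thesis
    using z nz unfolding G1_mult_def
    by (subst T_apply) (simp_all add: T_inv_def w flip: w_def)
qed

lemma continuous_on_T:
  assumes "continuous_on UNIV f" shows "continuous_on (ball 0 1) (T f)"
proof -
  have "continuous_on (ball 0 1) (\<lambda>z. (1 - norm z) * f (z /\<^sub>R (1 - norm z)))"
    by (intro continuous_intros continuous_on_compose2[OF assms]) auto
  then show ?thesis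
    by (rule continuous_on_eq) (simp add: T_apply)
qed

lemma bounded_T:
  assumes "f \<in> G1" shows "bounded (T f ` ball 0 1)"
proof -
  obtain C where C: "\<And>z. \<bar>f z\<bar> \<le> C * (1 + norm z)"
    using assms by (auto simp: G1_def)
  have "\<bar>T f z\<bar> \<le> C" if z: "z \<in> ball 0 1" for z
  proof -
    have "\<bar>T f z\<bar> = (1 - norm z) * \<bar>f (z /\<^sub>R (1 - norm z))\<bar>"
      using z by (simp add: T_apply abs_mult)
    also have "\<dots> \<le> (1 - norm z) * (C * (1 + norm (z /\<^sub>R (1 - norm z))))"
      using z by (intro mult_left_mono C) auto
    also have "\<dots> = C"
      using z by (simp add: field_simps)
    finally show ?thesis .
  qed
  then show ?thesis by (auto simp: bounded_iff intro!: exI[of _ C])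
qed

lemma G1_diff: "f \<in> G1 \<Longrightarrow> g \<in> G1 \<Longrightarrow> (\<lambda>z. f z - g z) \<in> G1"
proof -
  assume f: "f \<in> G1" and g: "g \<in> G1"
  obtain C where C: "\<And>z. \<bar>f z\<bar> \<le> C * (1 + norm z)" using f by (auto simp: G1_def)
  obtain D where D: "\<And>z. \<bar>g z\<bar> \<le> D * (1 + norm z)" using g by (auto simp: G1_def)
  have "\<bar>f z - g z\<bar> \<le> (C + D) * (1 + norm z)" for z
    using C[of z] D[of z] by (simp add: algebra_simps)
  then show ?thesis
    using f g by (auto simp: G1_def intro!: continuous_on_diff)
qed

lemma T_diff_le_G1_norm:
  assumes "f \<in> G1" "g \<in> G1" "z \<in> ball 0 1"
  shows "\<bar>T f z - T g z\<bar> \<le> G1_norm (\<lambda>z. f z - g z)"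
proof -
  \<comment> \<open>A real \<open>SUP\<close> is known to dominate its members only for a set
    bounded above; linear growth of both functions supplies this.\<close>
  have "bdd_above ((\<lambda>z. \<bar>T (\<lambda>z. f z - g z) z\<bar>) ` ball 0 1)"
    using bounded_T[OF G1_diff[OF assms(1,2)]] by (force simp: bounded_iff bdd_above_def)
  then have "\<bar>T (\<lambda>z. f z - g z) z\<bar> \<le> G1_norm (\<lambda>z. f z - g z)"
    unfolding G1_norm_def using assms(3) by (rule cSUP_upper2) auto
  then show ?thesis
    using assms(3) by (simp add: T_apply algebra_simps)
qed

text \<open>Both distances on the right are measured to \<open>g\<close>, the shape that occurs when
  \<open>f\<close> and \<open>h\<close> are close to the same point of a dense set.\<close>

lemma G1_norm_triangle:
  assumes "f \<in> G1" "g \<in> G1" "h \<in> G1"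
  shows "G1_norm (\<lambda>z. f z - h z) \<le> G1_norm (\<lambda>z. f z - g z) + G1_norm (\<lambda>z. h z - g z)"
  unfolding G1_norm_def[of "\<lambda>z. f z - h z"]
proof (rule cSUP_least)
  fix z :: 'a assume z: "z \<in> ball 0 1"
  have "\<bar>T (\<lambda>z. f z - h z) z\<bar> = \<bar>(T f z - T g z) - (T h z - T g z)\<bar>"
    using z by (simp add: T_apply algebra_simps)
  with T_diff_le_G1_norm[OF assms(1,2) z] T_diff_le_G1_norm[OF assms(3,2) z]
  show "\<bar>T (\<lambda>z. f z - h z) z\<bar> \<le> G1_norm (\<lambda>z. f z - g z) + G1_norm (\<lambda>z. h z - g z)"
    by linarith
qed simp

lemma topspace_cube:
  "topspace (cube A) = (\<Pi>\<^sub>E g\<in>T ` A. {(INF z\<in>ball 0 1. g z)..(SUP z\<in>ball 0 1. g z)})"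
  by (simp add: cube_def)

lemma continuous_map_cube_coord:
  "g \<in> T ` A \<Longrightarrow> continuous_map (cube A) euclideanreal (\<lambda>p. p g)"
  unfolding cube_def
  by (rule continuous_map_into_fulltopology, erule continuous_map_product_projection)

lemma continuous_map_emb_cube:
  assumes A: "A \<subseteq> G1" shows "continuous_map (top_of_set (ball 0 1)) (cube A) (emb A)"
  unfolding cube_def continuous_map_componentwise
proof (intro conjI ballI)
  show "emb A ` topspace (top_of_set (ball 0 1)) \<subseteq> extensional (T ` A)"
    by (auto simp: emb_def)
  fix g assume g: "g \<in> T ` A"
  then obtain f where f: "f \<in> A" "g = T f" by blast
  have "bounded (g ` ball 0 1)" using bounded_T f A by blast
  then have "g z \<in> {(INF z\<in>ball 0 1. g z)..(SUP z\<in>ball 0 1. g z)}" if "z \<in> ball 0 1" for z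
    using that by (auto intro!: cINF_lower cSUP_upper bounded_imp_bdd_above bounded_imp_bdd_below)
  moreover have "continuous_on (ball 0 1) g"
    using f A continuous_on_T by (auto simp: G1_def)
  ultimately show "continuous_map (top_of_set (ball 0 1))
      (top_of_set {(INF z\<in>ball 0 1. g z)..(SUP z\<in>ball 0 1. g z)}) (\<lambda>z. emb A z g)"
    using g by (auto simp: emb_def continuous_map_in_subtopology)
qed

lemma topspace_K: "topspace (K A) = cube A closure_of (emb A ` ball 0 1)"
  using closure_of_subset_topspace by (fastforce simp: K_def)

lemma emb_image_subset_K:
  assumes "A \<subseteq> G1" shows "emb A ` ball 0 1 \<subseteq> topspace (K A)"
  using continuous_map_image_subset_topspace[OF continuous_map_emb_cube[OF assms]]
  by (simp add: topspace_K closure_of_subset)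

lemma continuous_map_emb:
  assumes "A \<subseteq> G1" shows "continuous_map (top_of_set (ball 0 1)) (K A) (emb A)"
  using continuous_map_emb_cube[OF assms] emb_image_subset_K[OF assms]
  by (auto simp: K_def topspace_K continuous_map_in_subtopology image_subset_iff_funcset)

lemma continuous_map_K_coord:
  "g \<in> T ` A \<Longrightarrow> continuous_map (K A) euclideanreal (\<lambda>p. p g)"
  unfolding K_def by (intro continuous_map_from_subtopology continuous_map_cube_coord)

lemma compact_space_K: "compact_space (K A)"
proof -
  have "compact_space (cube A)"
    by (simp add: cube_def compact_space_product_topology compact_space_subtopology)
  then show ?thesis
    unfolding K_def
    by (intro compact_space_subtopology closedin_compact_space closedin_closure_of)
qed

lemma Hausdorff_space_K: "Hausdorff_space (K A)"
  unfolding K_def cube_def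
  by (intro Hausdorff_space_subtopology) (simp add: Hausdorff_space_product_topology Hausdorff_space_subtopology)

lemma K_closure_emb:
  assumes "A \<subseteq> G1" shows "K A closure_of (emb A ` ball 0 1) = topspace (K A)"
proof -
  have "cube A closure_of (emb A ` ball 0 1) \<inter> emb A ` ball 0 1 = emb A ` ball 0 1"
    using emb_image_subset_K[OF assms] by (simp add: topspace_K Int_absorb1)
  then show ?thesis
    unfolding topspace_K by (simp add: K_def closure_of_subtopology)
qed

text \<open>The image of the ball is dense and the reals are Hausdorff. This is the transfer
  principle for algebraic identities: what holds for \<open>T f\<close> on the ball passes to the
  coordinates of every point of the compactification.\<close>

lemma K_eqI:
  assumes "A \<subseteq> G1" "p \<in> topspace (K A)"
    and "continuous_map (K A) euclideanreal F" "continuous_map (K A) euclideanreal H"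
    and "\<And>z. z \<in> ball 0 1 \<Longrightarrow> F (emb A z) = H (emb A z)"
  shows "F p = (H p :: real)"
  using assms by (intro forall_in_closure_of_eq[of p "K A" "emb A ` ball 0 1" euclideanreal F H])
    (auto simp: K_closure_emb)

lemma emb_apply: "f \<in> A \<Longrightarrow> emb A z (T f) = T f z"
  by (simp add: emb_def)

section \<open>Points of \<open>K A\<close> as contractive multiplicative functionals on
  \<open>A\<close>\<close>

text \<open>A closed condition that holds on the dense ball. The estimate is uniform in
  \<open>p\<close>, which is why a norm-dense subset of the algebra controls all coordinates at
  once.\<close>

lemma K_coord_diff_le:
  assumes A: "A \<subseteq> G1" and p: "p \<in> topspace (K A)" and fg: "f \<in> A" "g \<in> A"
  shows "\<bar>p (T f) - p (T g)\<bar> \<le> G1_norm (\<lambda>z. f z - g z)"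
proof (rule forall_in_closure_of[of p "K A" "emb A ` ball 0 1" "\<lambda>p. \<bar>p (T f) - p (T g)\<bar> \<le> _"])
  show "p \<in> K A closure_of (emb A ` ball 0 1)" using p K_closure_emb[OF A] by simp
  show "\<bar>x (T f) - x (T g)\<bar> \<le> G1_norm (\<lambda>z. f z - g z)" if "x \<in> emb A ` ball 0 1" for x
    using that T_diff_le_G1_norm[OF subsetD[OF A fg(1)] subsetD[OF A fg(2)]] fg by (auto simp: emb_apply)
  have "continuous_map (K A) euclideanreal (\<lambda>p. \<bar>p (T f) - p (T g)\<bar>)"
    using fg by (intro continuous_intros continuous_map_K_coord) auto
  from closedin_continuous_map_preimage[OF this, of "{..G1_norm (\<lambda>z. f z - g z)}"]
  show "closedin (K A) {p \<in> topspace (K A). \<bar>p (T f) - p (T g)\<bar> \<le> G1_norm (\<lambda>z. f z - g z)}"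
    by simp
qed

lemma K_coord_add:
  assumes A: "A \<subseteq> G1" and p: "p \<in> topspace (K A)" and mem: "f \<in> A" "g \<in> A" "(\<lambda>z. f z + g z) \<in> A"
  shows "p (T (\<lambda>z. f z + g z)) = p (T f) + p (T g)"
proof (rule K_eqI[where F="\<lambda>p. p (T (\<lambda>z. f z + g z))" and H="\<lambda>p. p (T f) + p (T g)", OF A p])
  show "continuous_map (K A) euclideanreal (\<lambda>p. p (T (\<lambda>z. f z + g z)))"
    "continuous_map (K A) euclideanreal (\<lambda>p. p (T f) + p (T g))"
    using mem by (intro continuous_intros continuous_map_K_coord; simp)+
  show "emb A z (T (\<lambda>z. f z + g z)) = emb A z (T f) + emb A z (T g)" if "z \<in> ball 0 1" for z
    using mem that by (simp add: emb_apply T_apply algebra_simps)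
qed

lemma K_coord_scale:
  assumes A: "A \<subseteq> G1" and p: "p \<in> topspace (K A)" and mem: "f \<in> A" "(\<lambda>z. c * f z) \<in> A"
  shows "p (T (\<lambda>z. c * f z)) = c * p (T f)"
proof (rule K_eqI[where F="\<lambda>p. p (T (\<lambda>z. c * f z))" and H="\<lambda>p. c * p (T f)", OF A p])
  show "continuous_map (K A) euclideanreal (\<lambda>p. p (T (\<lambda>z. c * f z)))"
    "continuous_map (K A) euclideanreal (\<lambda>p. c * p (T f))"
    using mem by (intro continuous_intros continuous_map_K_coord; simp)+
  show "emb A z (T (\<lambda>z. c * f z)) = c * emb A z (T f)" if "z \<in> ball 0 1" for z
    using mem that by (simp add: emb_apply T_apply)
qed

lemma K_coord_mult:
  assumes A: "A \<subseteq> G1" and p: "p \<in> topspace (K A)" and mem: "f \<in> A" "g \<in> A" "G1_mult f g \<in> A"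
  shows "p (T (G1_mult f g)) = p (T f) * p (T g)"
proof (rule K_eqI[where F="\<lambda>p. p (T (G1_mult f g))" and H="\<lambda>p. p (T f) * p (T g)", OF A p])
  show "continuous_map (K A) euclideanreal (\<lambda>p. p (T (G1_mult f g)))"
    "continuous_map (K A) euclideanreal (\<lambda>p. p (T f) * p (T g))"
    using mem by (intro continuous_intros continuous_map_K_coord; simp)+
  show "emb A z (T (G1_mult f g)) = emb A z (T f) * emb A z (T g)" if "z \<in> ball 0 1" for z
    using mem that by (simp add: emb_apply T_G1_mult)
qed

lemma extension_to_K_coord:
  assumes "A \<subseteq> G1" "f \<in> A" shows "extension_to_K A f (\<lambda>p. p (T f))"
  using assms by (auto simp: extension_to_K_def emb_apply continuous_map_K_coord)

text \<open>The unit has transform 1 on the ball, so it extends to every compactification whether or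
  not the algebra contains it.\<close>

lemma extension_to_K_one: "extension_to_K A (\<lambda>z. 1 + norm z) (\<lambda>p. 1)"
  by (simp add: extension_to_K_def T_one_plus_norm)

section \<open>The ball as an open subset of \<open>K A\<close>, and extension by zero\<close>

lemma inj_on_emb:
  assumes "separates_points_closed A" shows "inj_on (emb A) (ball 0 1)"
proof (rule inj_onI, rule ccontr)
  fix y z assume yz: "y \<in> ball 0 1" "z \<in> ball 0 1" "emb A y = emb A z" "y \<noteq> z"
  have "closedin (top_of_set (ball 0 1)) {y}"
    using yz by (auto intro!: closed_subset)
  then obtain g where g: "g \<in> T ` A" "g z \<notin> closure (g ` {y})"
    using assms yz unfolding separates_points_closed_def by blast
  have "emb A y g = emb A z g" using yz by simp
  then show False using g by (simp add: emb_def)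
qed

lemma closedin_emb_image:
  assumes "A \<subseteq> G1" "compact Q" "Q \<subseteq> ball 0 1" shows "closedin (K A) (emb A ` Q)"
  using assms
  by (intro compactin_imp_closedin[OF Hausdorff_space_K] image_compactin[OF _ continuous_map_emb])
    (auto simp: compactin_subtopology)

text \<open>Separation of points from closed sets confines a neighbourhood of \<open>emb A z\<close> to the closure
  of the image of a small compact ball around \<open>z\<close>, which is that image itself.\<close>

lemma openin_emb_image:
  assumes A: "A \<subseteq> G1" and sep: "separates_points_closed A" and U: "open U" "U \<subseteq> ball 0 1"
  shows "openin (K A) (emb A ` U)"
proof (subst openin_subopen, intro ballI)
  fix x assume "x \<in> emb A ` U"
  then obtain z where z: "z \<in> U" "x = emb A z" by blast
  obtain e where e: "e > 0" "cball z e \<subseteq> U"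
    using U(1) z(1) open_contains_cball by blast
  define Q where "Q = emb A ` cball z e"
  have Q: "closedin (K A) Q"
    unfolding Q_def using A e U by (intro closedin_emb_image) auto
  have zC: "z \<in> ball 0 1 - (ball 0 1 - ball z e)" using z U e by auto
  have "closedin (top_of_set (ball 0 1)) (ball 0 1 - ball z e)"
    unfolding Diff_eq by (rule closedin_closed_Int) (simp add: closed_Compl)
  then obtain g where g: "g \<in> T ` A" "g z \<notin> closure (g ` (ball 0 1 - ball z e))"
    using sep zC unfolding separates_points_closed_def by blast
  define V where "V = {p \<in> topspace (K A). p g \<in> - closure (g ` (ball 0 1 - ball z e))}"
  have V: "openin (K A) V"
    unfolding V_def by (rule openin_continuous_map_preimage[OF continuous_map_K_coord[OF g(1)]]) auto
  have emb_V: "emb A y \<in> V \<longleftrightarrow> g y \<notin> closure (g ` (ball 0 1 - ball z e))" if "y \<in> ball 0 1" for y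
    using that emb_image_subset_K[OF A] g(1) by (auto simp: V_def emb_def)
  have "V \<subseteq> Q"
  proof (rule ccontr)
    assume "\<not> V \<subseteq> Q"
    \<comment> \<open>Since \<open>V - Q\<close> is open, density yields a \<open>y\<close> in the
      ball whose image lies in it. Then \<open>g y\<close> avoids the values of \<open>g\<close> off
      \<open>ball z e\<close>, which forces \<open>y\<close> into \<open>ball z e\<close> and its
      image into \<open>Q\<close>.\<close>
    then obtain p where p: "p \<in> V - Q" by blast
    then have "p \<in> K A closure_of (emb A ` ball 0 1)"
      by (simp add: K_closure_emb[OF A] V_def)
    moreover have "openin (K A) (V - Q)" using V Q by (rule openin_diff)
    ultimately obtain y where y: "y \<in> ball 0 1" "emb A y \<in> V - Q"
      using p unfolding in_closure_of by blast
    then have "g y \<notin> closure (g ` (ball 0 1 - ball z e))"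
      using emb_V by blast
    then have "g y \<notin> g ` (ball 0 1 - ball z e)"
      using closure_subset by (rule contra_subsetD[rotated])
    then have "y \<in> ball z e" using y by blast
    then show False using y by (auto simp: Q_def)
  qed
  moreover have "x \<in> V" using emb_V z U g by blast
  moreover have "Q \<subseteq> emb A ` U" using e by (auto simp: Q_def)
  ultimately show "\<exists>W. openin (K A) W \<and> x \<in> W \<and> W \<subseteq> emb A ` U"
    using V by blast
qed

text \<open>An open set without 0 pulls back to the image of an open subset of the ball, an open set
  with 0 to the complement of the image of a compact one; both are open in \<open>K A\<close>.
  Vanishing on the boundary is what removes the concentration term from a limit.\<close>

lemma extension_to_K_compact_support:
  fixes f :: "'d::euclidean_space \<Rightarrow> real"
  assumes A: "A \<subseteq> G1" and sep: "separates_points_closed A"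
    and f: "continuous_on UNIV f" and R: "R > 0" and supp: "\<And>z. norm z \<ge> R \<Longrightarrow> f z = 0"
  shows "\<exists>F. extension_to_K A f F \<and> (\<forall>p\<in>topspace (bdry A). F p = 0)"
proof -
  let ?B = "ball (0::'d) 1"
  define F where "F p = (if p \<in> emb A ` ?B then T f (inv_into ?B (emb A) p) else 0)" for p
  have Femb: "F (emb A z) = T f z" if "z \<in> ?B" for z
    using that inj_on_emb[OF sep] by (simp add: F_def)
  \<comment> \<open>The map w/(1+|w|) sends the sphere of radius \<open>R\<close> to radius R/(1+R),
    so \<open>T f\<close> vanishes from radius \<open>r\<close> on.\<close>
  define r where "r = R / (1 + R)"
  have r: "r < 1" using R by (simp add: r_def)
  have T0: "T f z = 0" if z: "z \<in> ?B" "norm z \<ge> r" for z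
  proof -
    have "R \<le> norm (z /\<^sub>R (1 - norm z))"
      using z R by (simp add: r_def field_simps)
    then show ?thesis using supp z by (simp add: T_apply)
  qed
  have contT: "continuous_on ?B (T f)" using f by (rule continuous_on_T)
  have "openin (K A) {p \<in> topspace (K A). F p \<in> U}" if U: "open U" for U
  proof (cases "0 \<in> U")
    case False
    have "{p \<in> topspace (K A). F p \<in> U} = emb A ` (?B \<inter> T f -` U)"
    proof (intro set_eqI iffI)
      fix p assume p: "p \<in> {p \<in> topspace (K A). F p \<in> U}"
      then obtain z where "z \<in> ?B" "p = emb A z"
        using False by (auto simp: F_def split: if_splits)
      with p Femb show "p \<in> emb A ` (?B \<inter> T f -` U)" by auto
    next
      fix p assume "p \<in> emb A ` (?B \<inter> T f -` U)"
      with Femb emb_image_subset_K[OF A] show "p \<in> {p \<in> topspace (K A). F p \<in> U}" by auto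
    qed
    moreover have "open (?B \<inter> T f -` U)"
      using contT U by (intro continuous_open_preimage) auto
    ultimately show ?thesis
      using openin_emb_image[OF A sep] by simp
  next
    case True
    \<comment> \<open>The points of the ball whose value escapes \<open>U\<close>. Beyond radius
      \<open>r\<close> the value is 0, which lies in \<open>U\<close>, so the closed ball of radius
      \<open>r\<close> catches all of them and makes \<open>Q\<close> compact.\<close>
    define Q where "Q = cball 0 r \<inter> T f -` (- U)"
    have QB: "Q \<subseteq> ?B" using r by (auto simp: Q_def)
    have "closed Q"
      unfolding Q_def using r U
      by (intro continuous_closed_preimage continuous_on_subset[OF contT]) auto
    then have "compact Q"
      using compact_Int_closed[OF compact_cball] by (metis Q_def inf_assoc inf.idem)
    then have "closedin (K A) (emb A ` Q)"
      using A QB by (intro closedin_emb_image)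
    moreover have "{p \<in> topspace (K A). F p \<in> U} = topspace (K A) - emb A ` Q"
    proof (intro set_eqI iffI)
      fix p assume "p \<in> {p \<in> topspace (K A). F p \<in> U}"
      then show "p \<in> topspace (K A) - emb A ` Q"
        using Femb QB by (auto simp: Q_def)
    next
      fix p assume p: "p \<in> topspace (K A) - emb A ` Q"
      show "p \<in> {p \<in> topspace (K A). F p \<in> U}"
      proof (cases "p \<in> emb A ` ?B")
        case True
        then obtain z where z: "z \<in> ?B" "p = emb A z" by blast
        then have "z \<notin> Q" using p by blast
        then have "T f z \<in> U"
          using \<open>0 \<in> U\<close> T0[OF z(1)] by (cases "norm z \<ge> r") (auto simp: Q_def)
        then show ?thesis using p z Femb by auto
      next
        case False
        then show ?thesis using p \<open>0 \<in> U\<close> by (simp add: F_def)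
      qed
    qed
    ultimately show ?thesis by (simp add: openin_diff)
  qed
  then have "continuous_map (K A) euclideanreal F"
    by (auto simp: continuous_map_def)
  then have "extension_to_K A f F"
    using Femb by (simp add: extension_to_K_def)
  moreover have "F p = 0" if "p \<in> topspace (bdry A)" for p
    using that by (auto simp: F_def bdry_def)
  ultimately show ?thesis by blast
qed

section \<open>Limits of Young measures\<close>

text \<open>Dominated convergence twice: inside against C(1+|z|) for almost every \<open>x\<close>,
  outside against \<open>b\<close> times its integral over \<open>\<nu> x\<close>, which is
  integrable because \<open>M\<close> is finite and the first moments are integrable over
  \<open>M\<close>.\<close>

lemma tendsto_integral_kernel:
  fixes \<nu> :: "'a \<Rightarrow> 'd::euclidean_space measure" and \<phi> :: "'a \<Rightarrow> real" and h :: "'d \<Rightarrow> real"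
  assumes fin: "finite_measure M" and \<nu>: "\<nu> \<in> M \<rightarrow>\<^sub>M prob_algebra borel"
    and mom: "(\<integral>\<^sup>+x. (\<integral>\<^sup>+z. ennreal (norm z) \<partial>\<nu> x) \<partial>M) < \<infinity>"
    and \<phi>[measurable]: "\<phi> \<in> borel_measurable M" and b: "\<And>x. \<bar>\<phi> x\<bar> \<le> b"
    and hn[measurable]: "\<And>n. hn n \<in> borel_measurable borel"
    and h[measurable]: "h \<in> borel_measurable borel"
    and bound: "\<And>n z. \<bar>hn n z\<bar> \<le> C * (1 + norm z)"
    and lim: "\<And>z. (\<lambda>n. hn n z) \<longlonglongrightarrow> h z"
  shows "(\<lambda>n. \<integral>x. \<phi> x * (\<integral>z. hn n z \<partial>\<nu> x) \<partial>M) \<longlonglongrightarrow> (\<integral>x. \<phi> x * (\<integral>z. h z \<partial>\<nu> x) \<partial>M)"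
proof -
  interpret M: finite_measure M by fact
  have \<nu>'[measurable]: "\<nu> \<in> M \<rightarrow>\<^sub>M subprob_algebra borel"
    using \<nu> by (rule measurable_prob_algebraD)
  have \<nu>x: "prob_space (\<nu> x)" "sets (\<nu> x) = sets borel" if "x \<in> space M" for x
    using measurable_space[OF \<nu> that] by (auto simp: space_prob_algebra)
  have meas: "(\<lambda>x. \<integral>z. g z \<partial>\<nu> x) \<in> borel_measurable M"
    if [measurable]: "g \<in> borel_measurable borel" for g :: "'d \<Rightarrow> real"
    by measurable
  \<comment> \<open>The double integral is finite, so the first moment is finite off a null set; the
    pointwise estimates below are made on its complement.\<close>
  have "AE x in M. (\<integral>\<^sup>+z. ennreal (norm z) \<partial>\<nu> x) \<noteq> \<infinity>"
    using mom by (intro nn_integral_PInf_AE) (auto simp: less_top)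
  then have int: "AE x in M. integrable (\<nu> x) norm \<and> x \<in> space M"
    using AE_space
  proof eventually_elim
    case (elim x)
    then show ?case
      using \<nu>x(2) by (auto simp: integrable_iff_bounded less_top cong: measurable_cong_sets)
  qed
  have C: "C \<ge> 0"
    using bound[of 0 0] by simp
  show ?thesis
  proof (rule integral_dominated_convergence[where w="\<lambda>x. b * (\<integral>z. C * (1 + norm z) \<partial>\<nu> x)"])
    show "(\<lambda>x. \<phi> x * (\<integral>z. h z \<partial>\<nu> x)) \<in> borel_measurable M"
      by measurable
    show "(\<lambda>x. \<phi> x * (\<integral>z. hn n z \<partial>\<nu> x)) \<in> borel_measurable M" for n
      by measurable
    have "integrable M (\<lambda>x. \<integral>z. norm z \<partial>\<nu> x)"
    proof (rule integrableI_bounded)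
      have "(\<integral>\<^sup>+x. ennreal (norm (\<integral>z. norm z \<partial>\<nu> x)) \<partial>M) = (\<integral>\<^sup>+x. (\<integral>\<^sup>+z. ennreal (norm z) \<partial>\<nu> x) \<partial>M)"
        by (rule nn_integral_cong_AE, use int in eventually_elim)
          (simp add: nn_integral_eq_integral)
      then show "(\<integral>\<^sup>+x. ennreal (norm (\<integral>z. norm z \<partial>\<nu> x)) \<partial>M) < \<infinity>"
        using mom by simp
    qed measurable
    then have *: "integrable M (\<lambda>x. C * (1 + (\<integral>z. norm z \<partial>\<nu> x)))"
      by simp
    have ae: "AE x in M. C * (1 + (\<integral>z. norm z \<partial>\<nu> x)) = (\<integral>z. C * (1 + norm z) \<partial>\<nu> x)"
      using int
    proof eventually_elim
      case (elim x)
      then interpret prob_space "\<nu> x" using \<nu>x by blast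
      show ?case using elim by (simp add: prob_space)
    qed
    have "integrable M (\<lambda>x. \<integral>z. C * (1 + norm z) \<partial>\<nu> x)"
      using ae by (subst integrable_cong_AE[OF _ _ AE_symmetric[OF ae]]) (use * in \<open>measurable\<close>)
    then show "integrable M (\<lambda>x. b * (\<integral>z. C * (1 + norm z) \<partial>\<nu> x))"
      by simp
    show "AE x in M. (\<lambda>n. \<phi> x * (\<integral>z. hn n z \<partial>\<nu> x)) \<longlonglongrightarrow> \<phi> x * (\<integral>z. h z \<partial>\<nu> x)"
      using int
    proof eventually_elim
      case (elim x)
      then interpret prob_space "\<nu> x" using \<nu>x by blast
      have [measurable_cong]: "sets (\<nu> x) = sets borel" using elim \<nu>x by blast
      have "(\<lambda>n. \<integral>z. hn n z \<partial>\<nu> x) \<longlonglongrightarrow> (\<integral>z. h z \<partial>\<nu> x)"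
        by (rule integral_dominated_convergence[where w="\<lambda>z. C * (1 + norm z)"])
          (use elim lim bound in auto)
      then show ?case by (rule tendsto_mult_left)
    qed
    show "AE x in M. norm (\<phi> x * (\<integral>z. hn n z \<partial>\<nu> x)) \<le> b * (\<integral>z. C * (1 + norm z) \<partial>\<nu> x)" for n
      using int
    proof eventually_elim
      case (elim x)
      then interpret prob_space "\<nu> x" using \<nu>x by blast
      have sets: "sets (\<nu> x) = sets borel" using elim \<nu>x by blast
      have w: "integrable (\<nu> x) (\<lambda>z. C * (1 + norm z))" using elim by simp
      have "integrable (\<nu> x) (hn n)"
      proof (rule Bochner_Integration.integrable_bound[OF w])
        show "hn n \<in> borel_measurable (\<nu> x)"
          unfolding measurable_cong_sets[OF sets refl] by (rule hn)
        show "AE z in \<nu> x. norm (hn n z) \<le> norm (C * (1 + norm z))"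
          using bound C by (simp add: abs_mult)
      qed
      then have "\<bar>\<integral>z. hn n z \<partial>\<nu> x\<bar> \<le> (\<integral>z. C * (1 + norm z) \<partial>\<nu> x)"
        using w bound by (intro order_trans[OF integral_abs_bound] integral_mono) auto
      then show ?case
        using b[of x] by (simp add: abs_mult mult_mono')
    qed
  qed
qed

section \<open>Borel sets of a topology, and the pieces of Young convergence\<close>

lemma space_borel_of: "space (borel_of X) = topspace X"
  by (simp add: borel_of_def space_measure_of_conv)

lemma sets_borel_of: "sets (borel_of X) = sigma_sets (topspace X) {U. openin X U}"
  unfolding borel_of_def by (rule sets_measure_of) (auto dest: openin_subset)

lemma borel_of_measurable_continuous_map:
  assumes f: "continuous_map X Y f" shows "f \<in> borel_of X \<rightarrow>\<^sub>M borel_of Y"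
  unfolding borel_of_def[of Y]
proof (rule measurable_measure_of)
  show "f \<in> space (borel_of X) \<rightarrow> topspace Y"
    using continuous_map_funspace[OF f] by (simp add: space_borel_of)
  fix U assume "U \<in> {U. openin Y U}"
  then have "openin X {x \<in> topspace X. f x \<in> U}"
    using openin_continuous_map_preimage[OF f] by simp
  moreover have "{x \<in> topspace X. f x \<in> U} = f -` U \<inter> topspace X" by auto
  ultimately have "openin X (f -` U \<inter> topspace X)" by simp
  then show "f -` U \<inter> space (borel_of X) \<in> sets (borel_of X)"
    by (simp add: sets_borel_of space_borel_of)
qed (auto dest: openin_subset)

lemma borel_of_euclidean: "borel_of (euclidean :: 'a::topological_space topology) = borel"
  by (simp only: borel_of_def borel_def topspace_euclidean open_openin[symmetric])

lemma space_borel_measure_on: "borel_measure_on S M \<Longrightarrow> space M = S"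
  using sets_eq_imp_space_eq[of M "restrict_space borel S"]
  by (simp add: borel_measure_on_def space_restrict_space)

lemma borel_measure_on_measurable:
  "borel_measure_on S M \<Longrightarrow> f \<in> borel_measurable borel \<Longrightarrow> f \<in> borel_measurable M"
  unfolding borel_measure_on_def
  by (simp add: measurable_restrict_space1 measurable_cong_sets[of M "restrict_space borel S"])

lemma young_convergesD:
  assumes "young_converges \<Omega> \<mu> A v \<nu> \<Lambda> \<nu>i"
  shows "\<nu> \<in> completion \<mu> \<rightarrow>\<^sub>M prob_algebra borel"
    and "(\<integral>\<^sup>+x. (\<integral>\<^sup>+z. ennreal (norm z) \<partial>\<nu> x) \<partial>completion \<mu>) < \<infinity>"
    and "borel_measure_on (closure \<Omega>) \<Lambda>"
    and "\<nu>i \<in> completion \<Lambda> \<rightarrow>\<^sub>M prob_algebra (borel_of (bdry A))"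
    and "\<And>\<phi> f F. continuous_on (closure \<Omega>) \<phi> \<Longrightarrow> continuous_on UNIV f \<Longrightarrow> extension_to_K A f F \<Longrightarrow>
      (\<lambda>j. \<integral>x. \<phi> x * f (v j x) \<partial>\<mu>) \<longlonglongrightarrow>
        (\<integral>x. \<phi> x * (\<integral>z. f z \<partial>\<nu> x) \<partial>completion \<mu>) + (\<integral>x. \<phi> x * (\<integral>p. F p \<partial>\<nu>i x) \<partial>completion \<Lambda>)"
  using assms unfolding young_converges_def by blast+

text \<open>Measurability puts the values of the family in \<open>prob_algebra\<close> at every
  point of the base space, which is all of \<open>closure \<Omega>\<close>; no null set is spent
  here.\<close>

lemma young_space:
  assumes "young_converges \<Omega> \<mu> A v \<nu> \<Lambda> \<nu>i" "x \<in> closure \<Omega>"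
  shows "prob_space (\<nu>i x)" "sets (\<nu>i x) = sets (borel_of (bdry A))"
    "space (\<nu>i x) = topspace (bdry A)"
proof -
  have "x \<in> space (completion \<Lambda>)"
    using assms(2) space_borel_measure_on[OF young_convergesD(3)[OF assms(1)]] by simp
  from measurable_space[OF young_convergesD(4)[OF assms(1)] this]
  show "prob_space (\<nu>i x)" and sets: "sets (\<nu>i x) = sets (borel_of (bdry A))"
    by (simp_all add: space_prob_algebra)
  show "space (\<nu>i x) = topspace (bdry A)"
    using sets_eq_imp_space_eq[OF sets] by (simp add: space_borel_of)
qed

lemma young_cutoff:
  fixes \<phi> :: "'n::euclidean_space \<Rightarrow> real"
  assumes Y: "young_converges \<Omega> \<mu> A v \<nu> \<Lambda> \<nu>i" and A: "A \<subseteq> G1" "separates_points_closed A"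
    and f: "continuous_on UNIV f" and R: "R > 0" and supp: "\<And>z. norm z \<ge> R \<Longrightarrow> f z = 0"
    and \<phi>: "continuous_on UNIV \<phi>"
  shows "(\<lambda>j. \<integral>x. \<phi> x * f (v j x) \<partial>\<mu>) \<longlonglongrightarrow> (\<integral>x. \<phi> x * (\<integral>z. f z \<partial>\<nu> x) \<partial>completion \<mu>)"
proof -
  obtain F where F: "extension_to_K A f F" "\<And>p. p \<in> topspace (bdry A) \<Longrightarrow> F p = 0"
    using extension_to_K_compact_support[OF A f R supp] by blast
  have space: "space \<Lambda> = closure \<Omega>"
    using space_borel_measure_on[OF young_convergesD(3)[OF Y]] .
  have "(\<integral>p. F p \<partial>\<nu>i x) = 0" if "x \<in> closure \<Omega>" for x
    by (rule integral_eq_zero_AE, rule AE_I2) (use young_space[OF Y that] F in auto)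
  then have "(\<integral>x. \<phi> x * (\<integral>p. F p \<partial>\<nu>i x) \<partial>completion \<Lambda>) = 0"
    by (intro integral_eq_zero_AE AE_I2) (auto simp: space)
  moreover have "(\<lambda>j. \<integral>x. \<phi> x * f (v j x) \<partial>\<mu>) \<longlonglongrightarrow>
      (\<integral>x. \<phi> x * (\<integral>z. f z \<partial>\<nu> x) \<partial>completion \<mu>) + (\<integral>x. \<phi> x * (\<integral>p. F p \<partial>\<nu>i x) \<partial>completion \<Lambda>)"
    by (rule young_convergesD(5)[OF Y continuous_on_subset[OF \<phi> subset_UNIV] f F(1)])
  ultimately show ?thesis by simp
qed

text \<open>The cutoffs of \<open>f\<close> extend to both compactifications even if
  \<open>f\<close> extends to neither, and the integrals along \<open>v\<close> do not know which
  compactification is used.\<close>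

lemma young_oscillation_integral_eq:
  fixes \<phi> :: "'n::euclidean_space \<Rightarrow> real"
  assumes Y: "young_converges \<Omega> \<mu> A v \<nu> \<Lambda> \<nu>i" and A: "A \<subseteq> G1" "separates_points_closed A"
    and Y': "young_converges \<Omega> \<mu> B v \<eta> \<Lambda>' \<eta>i" and B: "B \<subseteq> G1" "separates_points_closed B"
    and \<mu>: "borel_measure_on \<Omega> \<mu>" and f: "f \<in> G1"
    and \<phi>: "continuous_on UNIV \<phi>" "bounded (range \<phi>)"
  shows "(\<integral>x. \<phi> x * (\<integral>z. f z \<partial>\<nu> x) \<partial>completion \<mu>) = (\<integral>x. \<phi> x * (\<integral>z. f z \<partial>\<eta> x) \<partial>completion \<mu>)"
proof -
  have cont: "continuous_on UNIV f" using f by (simp add: G1_def)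
  obtain C where C: "\<And>z. \<bar>f z\<bar> \<le> C * (1 + norm z)" using f by (auto simp: G1_def)
  obtain b where b: "\<And>x. \<bar>\<phi> x\<bar> \<le> b" using \<phi>(2) by (auto simp: bounded_iff)
  \<comment> \<open>The cutoff factor is 1 up to radius \<open>n\<close> and 0 from radius
    \<open>n + 1\<close> on; the shift by one keeps the support radius positive for
    \<open>n = 0\<close>.\<close>
  define hn where "hn n z = f z * max 0 (min 1 (real n + 1 - norm z))" for n z
  have hn_cont: "continuous_on UNIV (hn n)" for n
    unfolding hn_def by (intro continuous_intros cont)
  have hn_supp: "hn n z = 0" if "norm z \<ge> real n + 1" for n z
    using that by (simp add: hn_def)
  have eq: "(\<integral>x. \<phi> x * (\<integral>z. hn n z \<partial>\<nu> x) \<partial>completion \<mu>) = (\<integral>x. \<phi> x * (\<integral>z. hn n z \<partial>\<eta> x) \<partial>completion \<mu>)" for n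
    by (rule LIMSEQ_unique[OF young_cutoff[OF Y A hn_cont _ hn_supp \<phi>(1)] young_cutoff[OF Y' B hn_cont _ hn_supp \<phi>(1)]])
      auto
  have "finite_measure (completion \<mu>)"
    using \<mu> finite_measure.emeasure_finite[of \<mu> "main_part \<mu> (space \<mu>)"]
      emeasure_completion[OF sets_completionI_sets[OF sets.top[of \<mu>]]]
    by (intro finite_measureI) (simp add: borel_measure_on_def)
  moreover have "\<phi> \<in> borel_measurable (completion \<mu>)"
    by (intro measurable_completion borel_measure_on_measurable[OF \<mu>]
        borel_measurable_continuous_onI[OF \<phi>(1)])
  moreover have "\<bar>hn n z\<bar> \<le> C * (1 + norm z)" for n z
  proof -
    have "\<bar>hn n z\<bar> \<le> \<bar>f z\<bar> * 1"
      unfolding hn_def abs_mult by (intro mult_left_mono) auto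
    then show ?thesis using C[of z] by simp
  qed
  moreover have "(\<lambda>n. hn n z) \<longlonglongrightarrow> f z" for z
  proof (rule tendsto_eventually)
    obtain m where "norm z \<le> real m" using real_arch_simple by blast
    then show "\<forall>\<^sub>F n in sequentially. hn n z = f z"
      by (intro eventually_sequentiallyI[of m]) (auto simp: hn_def)
  qed
  moreover have "hn n \<in> borel_measurable borel" "f \<in> borel_measurable borel" for n
    using hn_cont cont borel_measurable_continuous_onI by blast+
  ultimately have "(\<lambda>n. \<integral>x. \<phi> x * (\<integral>z. hn n z \<partial>\<kappa> x) \<partial>completion \<mu>)
      \<longlonglongrightarrow> (\<integral>x. \<phi> x * (\<integral>z. f z \<partial>\<kappa> x) \<partial>completion \<mu>)"
    if "\<kappa> \<in> completion \<mu> \<rightarrow>\<^sub>M prob_algebra borel"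
      "(\<integral>\<^sup>+x. (\<integral>\<^sup>+z. ennreal (norm z) \<partial>\<kappa> x) \<partial>completion \<mu>) < \<infinity>" for \<kappa>
    using that b by (intro tendsto_integral_kernel[where b=b and C=C])
  from this[OF young_convergesD(1,2)[OF Y]] this[OF young_convergesD(1,2)[OF Y']] show ?thesis
    unfolding eq by (rule LIMSEQ_unique)
qed

text \<open>\<open>F\<close> and \<open>F'\<close> live on different spaces and are linked only by
  \<open>f\<close>: both limit formulas describe the same numbers, and the equal oscillation parts
  cancel.\<close>

lemma young_concentration_integral_eq:
  fixes \<phi> :: "'n::euclidean_space \<Rightarrow> real"
  assumes Y: "young_converges \<Omega> \<mu> A v \<nu> \<Lambda> \<nu>i" and A: "A \<subseteq> G1" "separates_points_closed A"
    and Y': "young_converges \<Omega> \<mu> B v \<eta> \<Lambda>' \<eta>i" and B: "B \<subseteq> G1" "separates_points_closed B"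
    and \<mu>: "borel_measure_on \<Omega> \<mu>" and f: "f \<in> G1"
    and F: "extension_to_K A f F" "extension_to_K B f F'"
    and \<phi>: "continuous_on UNIV \<phi>" "bounded (range \<phi>)"
  shows "(\<integral>x. \<phi> x * (\<integral>p. F p \<partial>\<nu>i x) \<partial>completion \<Lambda>) = (\<integral>x. \<phi> x * (\<integral>p. F' p \<partial>\<eta>i x) \<partial>completion \<Lambda>')"
proof -
  have f': "continuous_on UNIV f" using f by (simp add: G1_def)
  have \<phi>': "continuous_on (closure \<Omega>) \<phi>" using \<phi>(1) by (rule continuous_on_subset) simp
  have "(\<lambda>j. \<integral>x. \<phi> x * f (v j x) \<partial>\<mu>) \<longlonglongrightarrow>
      (\<integral>x. \<phi> x * (\<integral>z. f z \<partial>\<nu> x) \<partial>completion \<mu>) + (\<integral>x. \<phi> x * (\<integral>p. F p \<partial>\<nu>i x) \<partial>completion \<Lambda>)"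
    by (rule young_convergesD(5)[OF Y \<phi>' f' F(1)])
  moreover have "(\<lambda>j. \<integral>x. \<phi> x * f (v j x) \<partial>\<mu>) \<longlonglongrightarrow>
      (\<integral>x. \<phi> x * (\<integral>z. f z \<partial>\<eta> x) \<partial>completion \<mu>) + (\<integral>x. \<phi> x * (\<integral>p. F' p \<partial>\<eta>i x) \<partial>completion \<Lambda>')"
    by (rule young_convergesD(5)[OF Y' \<phi>' f' F(2)])
  ultimately show ?thesis
    unfolding young_oscillation_integral_eq[OF Y A Y' B \<mu> f \<phi>]
    by (blast dest: LIMSEQ_unique add_left_imp_eq)
qed

lemma young_concentration_measure_eq:
  assumes Y: "young_converges \<Omega> \<mu> A v \<nu> \<Lambda> \<nu>i" and A: "A \<subseteq> G1" "separates_points_closed A"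
    and Y': "young_converges \<Omega> \<mu> B v \<eta> \<Lambda>' \<eta>i" and B: "B \<subseteq> G1" "separates_points_closed B"
    and \<mu>: "borel_measure_on (\<Omega> :: 'n::euclidean_space set) \<mu>"
  shows "\<Lambda> = \<Lambda>'"
proof (rule borel_measure_on_eqI[where S="closure \<Omega>"])
  show borel: "borel_measure_on (closure \<Omega>) \<Lambda>" "borel_measure_on (closure \<Omega>) \<Lambda>'"
    using young_convergesD(3) Y Y' by blast+
  fix \<phi> :: "'n \<Rightarrow> real" assume \<phi>: "continuous_on UNIV \<phi>" "bounded (range \<phi>)"
  have one: "(\<lambda>z. 1 + norm z) \<in> G1"
    by (auto simp: G1_def intro!: continuous_intros exI[of _ 1])
  have *: "(\<integral>x. \<phi> x * (\<integral>p. 1 \<partial>\<kappa> x) \<partial>completion P) = (\<integral>x. \<phi> x \<partial>P)"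
    if "young_converges \<Omega> \<mu> E v' \<tau> P \<kappa>" for E v' \<tau> P and \<kappa> :: "'n \<Rightarrow> (('a \<Rightarrow> real) \<Rightarrow> real) measure"
  proof -
    have P: "borel_measure_on (closure \<Omega>) P"
      using young_convergesD(3)[OF that] .
    have "(\<integral>x. \<phi> x * (\<integral>p. 1 \<partial>\<kappa> x) \<partial>completion P) = (\<integral>x. \<phi> x \<partial>completion P)"
      using young_space(1)[OF that] space_borel_measure_on[OF P]
      by (intro Bochner_Integration.integral_cong) (simp_all add: prob_space.prob_space)
    also have "\<dots> = (\<integral>x. \<phi> x \<partial>P)"
      by (intro integral_completion borel_measure_on_measurable[OF P]
          borel_measurable_continuous_onI[OF \<phi>(1)])
    finally show ?thesis .
  qed
  show "integral\<^sup>L \<Lambda> \<phi> = integral\<^sup>L \<Lambda>' \<phi>"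
    using young_concentration_integral_eq[OF Y A Y' B \<mu> one extension_to_K_one extension_to_K_one \<phi>]
    unfolding *[OF Y] *[OF Y'] .
qed simp

section \<open>Projections onto a common compactification\<close>

text \<open>Forgetting coordinates sends \<open>emb A z\<close> to \<open>emb \<Gamma> z\<close>,
  and a continuous map carries a closure into the closure of the image; so points of
  \<open>K A\<close> land in \<open>K \<Gamma>\<close> and not merely in the cube.\<close>

lemma continuous_map_forget:
  assumes \<Gamma>: "\<Gamma> \<subseteq> A" and A: "A \<subseteq> G1"
  shows "continuous_map (K A) (K \<Gamma>) (forget \<Gamma>)"
proof -
  have *: "continuous_map (cube A) (cube \<Gamma>) (forget \<Gamma>)"
    unfolding cube_def[of \<Gamma>] continuous_map_componentwise
  proof (intro conjI ballI)
    show "forget \<Gamma> ` topspace (cube A) \<subseteq> extensional (T ` \<Gamma>)"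
      by (auto simp: forget_def)
    fix g assume g: "g \<in> T ` \<Gamma>"
    then have "g \<in> T ` A" using \<Gamma> by blast
    then have "continuous_map (cube A) (top_of_set {(INF z\<in>ball 0 1. g z)..(SUP z\<in>ball 0 1. g z)}) (\<lambda>p. p g)"
      unfolding cube_def by (rule continuous_map_product_projection)
    then show "continuous_map (cube A) (top_of_set {(INF z\<in>ball 0 1. g z)..(SUP z\<in>ball 0 1. g z)})
        (\<lambda>p. forget \<Gamma> p g)"
      using g by (simp add: forget_def)
  qed
  have emb: "forget \<Gamma> ` emb A ` ball 0 1 = emb \<Gamma> ` ball 0 1"
  proof -
    have "forget \<Gamma> (emb A z) = emb \<Gamma> z" for z
      using \<Gamma> by (auto simp: forget_def emb_def restrict_def fun_eq_iff)
    then show ?thesis by (simp add: image_image)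
  qed
  have "forget \<Gamma> ` topspace (K A) \<subseteq> cube \<Gamma> closure_of (emb \<Gamma> ` ball 0 1)"
    using continuous_map_image_closure_subset[OF *, of "emb A ` ball 0 1"]
    by (simp add: topspace_K emb)
  moreover have "continuous_map (K A) (cube \<Gamma>) (forget \<Gamma>)"
    unfolding K_def[of A] using * by (rule continuous_map_from_subtopology)
  ultimately show ?thesis
    unfolding K_def[of \<Gamma>] by (intro continuous_map_into_subtopology) auto
qed

lemma G1_subalgebra_Int: "G1_subalgebra A \<Longrightarrow> G1_subalgebra B \<Longrightarrow> G1_subalgebra (A \<inter> B)"
  unfolding G1_subalgebra_def by blast

text \<open>A dense set of \<open>A\<close> may miss \<open>\<Gamma>\<close>. For each of its points
  \<open>g\<close> and each \<open>n\<close>, an element of \<open>\<Gamma>\<close> within 1/(n+1)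
  of \<open>g\<close> is chosen whenever there is one; there are only countably many such
  pairs.\<close>

lemma G1_separable_subset:
  assumes sep: "G1_separable A" and A: "A \<subseteq> G1" and \<Gamma>: "\<Gamma> \<subseteq> A"
  shows "G1_separable \<Gamma>"
proof -
  obtain D where D: "D \<subseteq> A" "countable D"
    and dense: "\<And>f \<epsilon>. f \<in> A \<Longrightarrow> \<epsilon> > 0 \<Longrightarrow> \<exists>g\<in>D. G1_norm (\<lambda>z. f z - g z) < \<epsilon>"
    using sep unfolding G1_separable_def by blast
  define near where "near g n h \<longleftrightarrow> h \<in> \<Gamma> \<and> G1_norm (\<lambda>z. h z - g z) < 1 / real (Suc n)" for g n h
  define D' where "D' = (\<lambda>(g, n). Eps (near g n)) ` {(g, n). g \<in> D \<and> Ex (near g n)}"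
  have near_Eps: "near g n (Eps (near g n))" if "near g n h" for g n h
    using someI[of "near g n", OF that] .
  show ?thesis
    unfolding G1_separable_def
  proof (intro exI[of _ D'] conjI ballI allI impI)
    have "{(g, n). g \<in> D \<and> Ex (near g n)} \<subseteq> D \<times> (UNIV :: nat set)" by auto
    then have "countable {(g, n). g \<in> D \<and> Ex (near g n)}"
      by (rule countable_subset) (use D(2) in simp)
    then show "countable D'" unfolding D'_def by (rule countable_image)
    show "D' \<subseteq> \<Gamma>"
      using near_Eps by (fastforce simp: D'_def near_def)
    fix f and \<epsilon> :: real assume f: "f \<in> \<Gamma>" and \<epsilon>: "\<epsilon> > 0"
    \<comment> \<open>Half of \<open>\<epsilon>\<close>, since \<open>f\<close> and the chosen
      \<open>h\<close> are both within 1/(n+1) of the same \<open>g\<close>.\<close>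
    obtain n where n: "1 / real (Suc n) < \<epsilon> / 2"
      using \<epsilon> by (metis half_gt_zero nat_approx_posE)
    obtain g where g: "g \<in> D" "G1_norm (\<lambda>z. f z - g z) < 1 / real (Suc n)"
      using dense[OF subsetD[OF \<Gamma> f], of "1 / real (Suc n)"] by fastforce
    define h where "h = Eps (near g n)"
    have "near g n f" using f g by (simp add: near_def)
    then have h: "near g n h" "h \<in> D'"
      using near_Eps[of g n f] g(1) by (auto simp: h_def D'_def)
    have "G1_norm (\<lambda>z. f z - h z) \<le> G1_norm (\<lambda>z. f z - g z) + G1_norm (\<lambda>z. h z - g z)"
    proof (rule G1_norm_triangle)
      show "f \<in> G1" "g \<in> G1" "h \<in> G1"
        using f g(1) h(1) D(1) \<Gamma> A by (auto simp: near_def)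
    qed
    also have "\<dots> < \<epsilon>"
      using g h(1) n by (simp add: near_def)
    finally show "\<exists>g\<in>D'. G1_norm (\<lambda>z. f z - g z) < \<epsilon>" using h by blast
  qed
qed

section \<open>Coordinate integrals against probability measures on \<open>K A\<close>\<close>

lemma K_coord_bound:
  assumes "p \<in> topspace (K A)" "g \<in> T ` A"
  shows "\<bar>p g\<bar> \<le> \<bar>INF z\<in>ball 0 1. g z\<bar> + \<bar>SUP z\<in>ball 0 1. g z\<bar>"
proof -
  have "p \<in> topspace (cube A)"
    using assms(1) by (simp add: K_def)
  then have "p g \<in> {(INF z\<in>ball 0 1. g z)..(SUP z\<in>ball 0 1. g z)}"
    using assms(2) by (auto simp: topspace_cube)
  then show ?thesis by auto
qed

lemma K_coord_borel:
  assumes "g \<in> T ` A" shows "(\<lambda>p. p g) \<in> borel_measurable (borel_of (K A))"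
  using borel_of_measurable_continuous_map[OF continuous_map_K_coord[OF assms]]
  by (simp add: borel_of_euclidean)

lemma integrable_K_coord:
  assumes P: "prob_space P" "sets P = sets (borel_of (K A))" and f: "f \<in> A"
  shows "integrable P (\<lambda>p. p (T f))"
proof -
  interpret prob_space P by fact
  have "(\<lambda>p. p (T f)) \<in> borel_measurable P"
    unfolding measurable_cong_sets[OF P(2) refl] using f by (intro K_coord_borel) simp
  moreover have "space P = topspace (K A)"
    using sets_eq_imp_space_eq[OF P(2)] by (simp add: space_borel_of)
  ultimately show ?thesis
    using K_coord_bound[of _ A "T f"] f
    by (intro integrable_const_bound[where B="\<bar>INF z\<in>ball 0 1. T f z\<bar> + \<bar>SUP z\<in>ball 0 1. T f z\<bar>"] AE_I2)
      simp_all
qed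

lemma prob_space_integral_diff_le:
  assumes "prob_space P" "integrable P f" "integrable P g"
    and "\<And>x. x \<in> space P \<Longrightarrow> \<bar>f x - g x\<bar> \<le> (e::real)"
  shows "\<bar>integral\<^sup>L P f - integral\<^sup>L P g\<bar> \<le> e"
proof -
  interpret prob_space P by fact
  have "\<bar>integral\<^sup>L P f - integral\<^sup>L P g\<bar> = \<bar>\<integral>x. f x - g x \<partial>P\<bar>"
    using assms(2,3) by simp
  also have "\<dots> \<le> (\<integral>x. \<bar>f x - g x\<bar> \<partial>P)"
    by (rule integral_abs_bound)
  also have "\<dots> \<le> (\<integral>x. e \<partial>P)"
  proof (rule integral_mono)
    show "integrable P (\<lambda>x. \<bar>f x - g x\<bar>)" using assms(2,3) by simp
  qed (use assms(4) in simp_all)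
  finally show ?thesis by (simp add: prob_space)
qed

text \<open>The factor 2 leaves room for one approximation error on each side, for two measures or
  for two points.\<close>

lemma eq_if_abs_diff_le:
  assumes "\<And>e. e > 0 \<Longrightarrow> \<bar>a - b\<bar> \<le> 2 * (e::real)" shows "a = b"
proof (rule ccontr)
  assume "a \<noteq> b"
  then show False using assms[of "\<bar>a - b\<bar> / 4"] by simp
qed

text \<open>By density of \<open>D\<close>, \<open>\<Phi>\<close> embeds \<open>K \<Gamma>\<close> homeomorphically into the sequence space. The class \<open>R\<close> carries an
  additive constant because the unit need not belong to \<open>\<Gamma>\<close>.\<close>

lemma borel_of_K_measure_eqI:
  fixes \<Gamma> :: "('d::euclidean_space \<Rightarrow> real) set"
  assumes alg: "G1_subalgebra \<Gamma>" and D: "D \<subseteq> \<Gamma>" "countable D"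
    and dense: "\<And>f \<epsilon>. f \<in> \<Gamma> \<Longrightarrow> \<epsilon> > 0 \<Longrightarrow> \<exists>g\<in>D. G1_norm (\<lambda>z. f z - g z) < \<epsilon>"
    and P: "prob_space P" "sets P = sets (borel_of (K \<Gamma>))"
    and Q: "prob_space Q" "sets Q = sets (borel_of (K \<Gamma>))"
    and eq: "\<And>f. f \<in> D \<Longrightarrow> (\<integral>p. p (T f) \<partial>P) = (\<integral>p. p (T f) \<partial>Q)"
  shows "P = Q"
proof -
  let ?X = "topspace (K \<Gamma>)"
  have \<Gamma>: "\<Gamma> \<subseteq> G1" and zero: "(\<lambda>z. 0) \<in> \<Gamma>"
    and add: "\<And>f g. f \<in> \<Gamma> \<Longrightarrow> g \<in> \<Gamma> \<Longrightarrow> (\<lambda>z. f z + g z) \<in> \<Gamma>"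
    and scale: "\<And>c f. f \<in> \<Gamma> \<Longrightarrow> (\<lambda>z. c * f z) \<in> \<Gamma>"
    and mult: "\<And>f g. f \<in> \<Gamma> \<Longrightarrow> g \<in> \<Gamma> \<Longrightarrow> G1_mult f g \<in> \<Gamma>"
    using alg unfolding G1_subalgebra_def by blast+
  have space: "space P = ?X" "space Q = ?X"
    using sets_eq_imp_space_eq[OF P(2)] sets_eq_imp_space_eq[OF Q(2)] by (simp_all add: space_borel_of)
  have eq\<Gamma>: "(\<integral>p. p (T f) \<partial>P) = (\<integral>p. p (T f) \<partial>Q)" if f: "f \<in> \<Gamma>" for f
  proof (rule eq_if_abs_diff_le)
    fix e :: real assume "e > 0"
    then obtain g where g: "g \<in> D" "G1_norm (\<lambda>z. f z - g z) < e"
      using dense f by blast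
    then have "g \<in> \<Gamma>" using D by blast
    have *: "\<bar>(\<integral>p. p (T f) \<partial>M) - (\<integral>p. p (T g) \<partial>M)\<bar> \<le> e"
      if M: "prob_space M" "sets M = sets (borel_of (K \<Gamma>))" "space M = ?X" for M
    proof (rule prob_space_integral_diff_le)
      show "integrable M (\<lambda>p. p (T f))" "integrable M (\<lambda>p. p (T g))"
        by (rule integrable_K_coord[OF M(1,2)], fact)+
      show "\<bar>p (T f) - p (T g)\<bar> \<le> e" if "p \<in> space M" for p
        using K_coord_diff_le[OF \<Gamma> _ f \<open>g \<in> \<Gamma>\<close>, of p] g(2) that M(3) by simp
    qed (rule M(1))
    show "\<bar>(\<integral>p. p (T f) \<partial>P) - (\<integral>p. p (T f) \<partial>Q)\<bar> \<le> 2 * e"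
      using *[OF P space(1)] *[OF Q space(2)] eq[OF g(1)] by linarith
  qed
  \<comment> \<open>\<open>D\<close> is nonempty because it approximates the zero function, so
    \<open>from_nat_into\<close> lists it as a sequence, with repetitions if \<open>D\<close> is
    finite.\<close>
  define d where "d = from_nat_into D"
  have "D \<noteq> {}" using dense[OF zero zero_less_one] by blast
  then have range_d: "range d = D" unfolding d_def using D(2) by (rule range_from_nat_into)
  define \<Phi> :: "(('d \<Rightarrow> real) \<Rightarrow> real) \<Rightarrow> nat \<Rightarrow> real" where "\<Phi> p = (\<lambda>n. p (T (d n)))" for p
  have \<Phi>_cont: "continuous_map (K \<Gamma>) euclidean \<Phi>"
    unfolding euclidean_product_topology[symmetric] continuous_map_componentwise_UNIV \<Phi>_def
    using range_d D(1) by (intro allI continuous_map_K_coord) blast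
  have \<Phi>_borel: "\<Phi> \<in> borel_measurable (borel_of (K \<Gamma>))"
    using borel_of_measurable_continuous_map[OF \<Phi>_cont] by (simp add: borel_of_euclidean)
  have \<Phi>P: "\<Phi> \<in> borel_measurable P" and \<Phi>Q: "\<Phi> \<in> borel_measurable Q"
    using \<Phi>_borel measurable_cong_sets[OF P(2) refl] measurable_cong_sets[OF Q(2) refl] by blast+
  \<comment> \<open>Points of \<open>K \<Gamma>\<close> are extensional, so only coordinates at
    \<open>T f\<close> with \<open>f\<close> in \<open>\<Gamma>\<close> matter, and each is a limit
    of coordinates indexed by \<open>D\<close>.\<close>
  have \<Phi>_inj: "inj_on \<Phi> ?X"
  proof (rule inj_onI)
    fix p q assume p: "p \<in> ?X" and q: "q \<in> ?X" and \<Phi>: "\<Phi> p = \<Phi> q"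
    have ext: "r \<in> extensional (T ` \<Gamma>)" if "r \<in> ?X" for r
      using that by (auto simp: K_def topspace_cube PiE_def)
    show "p = q"
    proof (rule extensionalityI[OF ext[OF p] ext[OF q]])
      fix x assume "x \<in> T ` \<Gamma>"
      then obtain f where f: "f \<in> \<Gamma>" "x = T f" by blast
      have "p (T f) = q (T f)"
      proof (rule eq_if_abs_diff_le)
        fix e :: real assume "e > 0"
        then obtain g where g: "g \<in> D" "G1_norm (\<lambda>z. f z - g z) < e"
          using dense f by blast
        then obtain n where "g = d n" using range_d by blast
        then have "p (T g) = q (T g)" using fun_cong[OF \<Phi>, of n] by (simp add: \<Phi>_def)
        moreover have "g \<in> \<Gamma>" using g D by blast
        ultimately show "\<bar>p (T f) - q (T f)\<bar> \<le> 2 * e"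
          using K_coord_diff_le[OF \<Gamma> p f(1), of g] K_coord_diff_le[OF \<Gamma> q f(1), of g] g by linarith
      qed
      then show "p x = q x" using f by simp
    qed
  qed
  define S where "S = \<Phi> ` ?X"
  have "compactin euclidean S"
    unfolding S_def using compact_space_K[of \<Gamma>]
    by (intro image_compactin[OF _ \<Phi>_cont]) (simp add: compact_space_def)
  then have S: "compact S" by simp
  define R where "R r \<longleftrightarrow> continuous_on S r \<and>
      (\<exists>c. \<exists>f\<in>\<Gamma>. \<forall>p\<in>?X. r (\<Phi> p) = c + p (T f))" for r :: "(nat \<Rightarrow> real) \<Rightarrow> real"
  have R_const: "R (\<lambda>_. c)" for c
  proof -
    have "p (T (\<lambda>z. 0)) = 0" if "p \<in> ?X" for p
      using K_coord_scale[OF \<Gamma> that zero, of 0] zero by simp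
    then show ?thesis
      unfolding R_def using zero by (intro conjI continuous_intros exI[of _ c] bexI[OF _ zero]) auto
  qed
  have R_add: "R (\<lambda>x. r x + s x)" and R_mult: "R (\<lambda>x. r x * s x)" if r: "R r" and s: "R s" for r s
  proof -
    obtain a f where f: "f \<in> \<Gamma>" "\<And>p. p \<in> ?X \<Longrightarrow> r (\<Phi> p) = a + p (T f)"
      using r unfolding R_def by blast
    obtain b g where g: "g \<in> \<Gamma>" "\<And>p. p \<in> ?X \<Longrightarrow> s (\<Phi> p) = b + p (T g)"
      using s unfolding R_def by blast
    have cont: "continuous_on S r" "continuous_on S s" using r s by (simp_all add: R_def)
    have "r (\<Phi> p) + s (\<Phi> p) = (a + b) + p (T (\<lambda>z. f z + g z))" if "p \<in> ?X" for p
      using that f g add by (simp add: K_coord_add[OF \<Gamma>])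
    then show "R (\<lambda>x. r x + s x)"
      unfolding R_def using cont add f g by (blast intro: continuous_on_add)
    \<comment> \<open>Expanding (a + f)(b + g): apart from the constant \<open>a * b\<close>, every
      term stays in the algebra.\<close>
    have "r (\<Phi> p) * s (\<Phi> p) = a * b + p (T (\<lambda>z. (a * g z + b * f z) + G1_mult f g z))"
      if p: "p \<in> ?X" for p
    proof -
      have "p (T (\<lambda>z. (a * g z + b * f z) + G1_mult f g z)) = (a * p (T g) + b * p (T f)) + p (T f) * p (T g)"
        using f(1) g(1) by (simp add: K_coord_add[OF \<Gamma> p] K_coord_scale[OF \<Gamma> p] K_coord_mult[OF \<Gamma> p] add scale mult)
      then show ?thesis using p f g by (simp add: algebra_simps)
    qed
    moreover have "(\<lambda>z. (a * g z + b * f z) + G1_mult f g z) \<in> \<Gamma>"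
      by (intro add scale mult f g)
    ultimately show "R (\<lambda>x. r x * s x)"
      unfolding R_def using cont by (blast intro: continuous_on_mult)
  qed
  have R_coord: "R (\<lambda>x. x n)" for n
  proof -
    have "continuous_on S (\<lambda>x. x n)"
      by (rule continuous_on_subset[OF continuous_on_product_coordinates]) simp
    moreover have "d n \<in> \<Gamma>" using range_d D by blast
    ultimately show ?thesis
      unfolding R_def by (intro conjI exI[of _ 0] bexI[of _ "d n"]) (auto simp: \<Phi>_def)
  qed
  have R_integral: "integrable M (\<lambda>p. r (\<Phi> p))" "(\<integral>p. r (\<Phi> p) \<partial>M) = c + (\<integral>p. p (T f) \<partial>M)"
    if M: "prob_space M" "sets M = sets (borel_of (K \<Gamma>))" "space M = ?X"
      and f: "f \<in> \<Gamma>" "\<And>p. p \<in> ?X \<Longrightarrow> r (\<Phi> p) = c + p (T f)" for M r c f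
  proof -
    interpret prob_space M by fact
    have int: "integrable M (\<lambda>p. p (T f))" using M f by (intro integrable_K_coord)
    have "integrable M (\<lambda>p. r (\<Phi> p)) \<longleftrightarrow> integrable M (\<lambda>p. c + p (T f))"
      using M(3) f(2) by (intro Bochner_Integration.integrable_cong) auto
    then show "integrable M (\<lambda>p. r (\<Phi> p))" using int by simp
    have "(\<integral>p. r (\<Phi> p) \<partial>M) = (\<integral>p. c + p (T f) \<partial>M)"
      using M(3) f(2) by (intro Bochner_Integration.integral_cong) auto
    then show "(\<integral>p. r (\<Phi> p) \<partial>M) = c + (\<integral>p. p (T f) \<partial>M)"
      using int by (simp add: prob_space)
  qed
  have distr_eq: "distr P borel \<Phi> = distr Q borel \<Phi>"
  proof (rule measure_eqI_continuous)
    show "finite_measure (distr P borel \<Phi>)" "finite_measure (distr Q borel \<Phi>)"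
      using P(1) Q(1) \<Phi>P \<Phi>Q
      by (simp_all add: prob_space.prob_space_distr prob_space.finite_measure)
    fix h :: "(nat \<Rightarrow> real) \<Rightarrow> real" assume h: "continuous_on UNIV h" "bounded (range h)"
    have h_borel: "h \<in> borel_measurable borel" using h(1) by (rule borel_measurable_continuous_onI)
    have h_int: "integrable M (\<lambda>p. h (\<Phi> p))" if "prob_space M" "\<Phi> \<in> borel_measurable M" for M
    proof -
      interpret prob_space M by fact
      obtain b where "\<And>x. norm (h x) \<le> b" using h(2) by (auto simp: bounded_iff)
      then show ?thesis
        using measurable_compose[OF that(2) h_borel] by (intro integrable_const_bound[where B=b]) auto
    qed
    have "(\<integral>p. h (\<Phi> p) \<partial>P) = (\<integral>p. h (\<Phi> p) \<partial>Q)"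
    proof (rule eq_if_abs_diff_le)
      fix e :: real assume e: "e > 0"
      \<comment> \<open>Approximation on the compact set \<open>S\<close> is enough, since
        \<open>\<Phi>\<close> maps the spaces of both measures into it. Distinct sequences differ in
        some coordinate, which gives the separation of points.\<close>
      have "\<exists>r. R r \<and> (\<forall>x\<in>S. \<bar>h x - r x\<bar> < e)"
      proof (rule Stone_Weierstrass_HOL[OF S])
        show "continuous_on S h" using h(1) by (rule continuous_on_subset) simp
        show "\<exists>r. R r \<and> r x \<noteq> r y" if "x \<in> S \<and> y \<in> S \<and> x \<noteq> y" for x y
          using that R_coord by (metis ext)
      qed (use R_const R_add R_mult e in \<open>auto simp: R_def\<close>)
      then obtain r where r: "R r" "\<And>x. x \<in> S \<Longrightarrow> \<bar>h x - r x\<bar> < e" by blast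
      obtain c f where f: "f \<in> \<Gamma>" "\<And>p. p \<in> ?X \<Longrightarrow> r (\<Phi> p) = c + p (T f)"
        using r(1) unfolding R_def by blast
      note RP = R_integral[where r=r, OF P space(1) f] and RQ = R_integral[where r=r, OF Q space(2) f]
      have "\<bar>(\<integral>p. h (\<Phi> p) \<partial>P) - (\<integral>p. r (\<Phi> p) \<partial>P)\<bar> \<le> e"
        using r(2) space by (intro prob_space_integral_diff_le P(1) h_int \<Phi>P RP(1)) (auto simp: S_def less_imp_le)
      moreover have "\<bar>(\<integral>p. h (\<Phi> p) \<partial>Q) - (\<integral>p. r (\<Phi> p) \<partial>Q)\<bar> \<le> e"
        using r(2) space by (intro prob_space_integral_diff_le Q(1) h_int \<Phi>Q RQ(1)) (auto simp: S_def less_imp_le)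
      moreover have "(\<integral>p. r (\<Phi> p) \<partial>P) = (\<integral>p. r (\<Phi> p) \<partial>Q)"
        using RP(2) RQ(2) eq\<Gamma>[OF f(1)] by simp
      ultimately show "\<bar>(\<integral>p. h (\<Phi> p) \<partial>P) - (\<integral>p. h (\<Phi> p) \<partial>Q)\<bar> \<le> 2 * e" by linarith
    qed
    then show "integral\<^sup>L (distr P borel \<Phi>) h = integral\<^sup>L (distr Q borel \<Phi>) h"
      using \<Phi>P \<Phi>Q h_borel by (simp add: integral_distr)
  qed simp_all
  \<comment> \<open>The complement of an open set is compact, its image is compact and so closed,
    and injectivity recovers the open set as a preimage. Thus all Borel sets of
    \<open>K \<Gamma>\<close> are preimages under \<open>\<Phi>\<close>, and equal push-forwards
    force equal measures.\<close>
  have "sigma_sets ?X {U. openin (K \<Gamma>) U} \<subseteq> sets (vimage_algebra ?X \<Phi> borel)"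
  proof (rule sets.sigma_sets_subset[of _ "vimage_algebra ?X \<Phi> borel", unfolded space_vimage_algebra], rule subsetI)
    fix U assume "U \<in> {U. openin (K \<Gamma>) U}"
    then have U: "openin (K \<Gamma>) U" by simp
    have "compactin (K \<Gamma>) (?X - U)"
      using U by (intro closedin_compact_space[OF compact_space_K] closedin_diff) auto
    then have "compactin euclidean (\<Phi> ` (?X - U))"
      using \<Phi>_cont by (rule image_compactin)
    then have "closed (\<Phi> ` (?X - U))" by (simp add: compact_imp_closed)
    then have "- \<Phi> ` (?X - U) \<in> sets borel" by (intro borel_open open_Compl)
    moreover have "U = \<Phi> -` (- \<Phi> ` (?X - U)) \<inter> ?X"
      using openin_subset[OF U] inj_onD[OF \<Phi>_inj] by blast
    ultimately show "U \<in> sets (vimage_algebra ?X \<Phi> borel)"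
      by (subst sets_vimage_algebra2) auto
  qed
  then have sets_sub: "sets (borel_of (K \<Gamma>)) \<subseteq> {\<Phi> -` V \<inter> ?X |V. V \<in> sets borel}"
    by (subst (asm) sets_vimage_algebra2) (auto simp: sets_borel_of)
  show ?thesis
  proof (rule measure_eqI)
    show "sets P = sets Q" using P Q by simp
    fix X assume "X \<in> sets P"
    then obtain V where V: "V \<in> sets borel" "X = \<Phi> -` V \<inter> ?X"
      using sets_sub P(2) by blast
    then have "emeasure P X = emeasure (distr P borel \<Phi>) V" "emeasure Q X = emeasure (distr Q borel \<Phi>) V"
      using \<Phi>P \<Phi>Q space by (simp_all add: emeasure_distr)
    then show "emeasure P X = emeasure Q X" by (simp add: distr_eq)
  qed
qed

text \<open>The target is all of \<open>K \<Gamma>\<close>: a boundary point of \<open>K A\<close>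
  may be sent into the image of the ball, as \<open>\<Gamma>\<close> may fail to separate points
  from closed sets.\<close>

lemma measurable_forget:
  assumes "\<Gamma> \<subseteq> A" "A \<subseteq> G1" "sets M = sets (borel_of (bdry A))"
  shows "forget \<Gamma> \<in> M \<rightarrow>\<^sub>M borel_of (K \<Gamma>)"
proof -
  have "continuous_map (bdry A) (K \<Gamma>) (forget \<Gamma>)"
    unfolding bdry_def using continuous_map_forget[OF assms(1,2)] by (rule continuous_map_from_subtopology)
  then show ?thesis
    unfolding measurable_cong_sets[OF assms(3) refl] by (rule borel_of_measurable_continuous_map)
qed

lemma proj_K_prob:
  assumes "\<Gamma> \<subseteq> A" "A \<subseteq> G1" "sets M = sets (borel_of (bdry A))" "prob_space M"
  shows "prob_space (proj_K \<Gamma> M)"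
  unfolding proj_K_def using measurable_forget[OF assms(1-3)] by (rule prob_space.prob_space_distr[OF assms(4)])

lemma sets_proj_K: "sets (proj_K \<Gamma> M) = sets (borel_of (K \<Gamma>))"
  by (simp add: proj_K_def)

lemma bdry_coord_borel:
  assumes "g \<in> T ` A" shows "(\<lambda>p. p g) \<in> borel_measurable (borel_of (bdry A))"
proof -
  have "continuous_map (bdry A) euclideanreal (\<lambda>p. p g)"
    unfolding bdry_def by (intro continuous_map_from_subtopology continuous_map_K_coord assms)
  then show ?thesis
    using borel_of_measurable_continuous_map by (fastforce simp: borel_of_euclidean)
qed

text \<open>Coordinates at functions of \<open>\<Gamma>\<close> survive the forgetting, so a change
  of variables brings measures from different boundaries to a common space without altering these
  integrals.\<close>

lemma integral_proj_K:
  assumes "\<Gamma> \<subseteq> A" "A \<subseteq> G1" "sets M = sets (borel_of (bdry A))" "f \<in> \<Gamma>"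
  shows "(\<integral>w. w (T f) \<partial>proj_K \<Gamma> M) = (\<integral>p. p (T f) \<partial>M)"
proof -
  have "(\<integral>w. w (T f) \<partial>proj_K \<Gamma> M) = (\<integral>p. forget \<Gamma> p (T f) \<partial>M)"
    unfolding proj_K_def using assms(4)
    by (intro integral_distr measurable_forget[OF assms(1-3)] K_coord_borel) simp
  also have "\<dots> = (\<integral>p. p (T f) \<partial>M)"
    using assms(4) by (simp add: forget_def)
  finally show ?thesis .
qed

text \<open>The bound involves only \<open>T f\<close>, so the same constant serves for both
  compactifications, as the almost everywhere comparison of two functions of \<open>x\<close>
  demands.\<close>

lemma young_coord_integral:
  assumes Y: "young_converges \<Omega> \<mu> A v \<nu> \<Lambda> \<nu>i" and f: "f \<in> A"
  shows "(\<lambda>x. \<integral>p. p (T f) \<partial>\<nu>i x) \<in> borel_measurable (completion \<Lambda>)"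
    and "x \<in> closure \<Omega> \<Longrightarrow>
      \<bar>\<integral>p. p (T f) \<partial>\<nu>i x\<bar> \<le> \<bar>INF z\<in>ball 0 1. T f z\<bar> + \<bar>SUP z\<in>ball 0 1. T f z\<bar>"
proof -
  have borel: "(\<lambda>p. p (T f)) \<in> borel_measurable (borel_of (bdry A))"
    using f by (intro bdry_coord_borel) simp
  show "(\<lambda>x. \<integral>p. p (T f) \<partial>\<nu>i x) \<in> borel_measurable (completion \<Lambda>)"
    by (rule measurable_compose[OF measurable_prob_algebraD[OF young_convergesD(4)[OF Y]]
          integral_measurable_subprob_algebra[OF borel]])
  let ?c = "\<bar>INF z\<in>ball 0 1. T f z\<bar> + \<bar>SUP z\<in>ball 0 1. T f z\<bar>"
  assume x: "x \<in> closure \<Omega>"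
  have "\<bar>p (T f)\<bar> \<le> ?c" if "p \<in> space (\<nu>i x)" for p
    using that f young_space(3)[OF Y x] by (intro K_coord_bound) (auto simp: bdry_def)
  moreover have "(\<lambda>p. p (T f)) \<in> borel_measurable (\<nu>i x)"
    unfolding measurable_cong_sets[OF young_space(2)[OF Y x] refl] by (rule borel)
  ultimately have "\<bar>(\<integral>p. p (T f) \<partial>\<nu>i x) - (\<integral>p. 0 \<partial>\<nu>i x)\<bar> \<le> ?c"
    using young_space(1)[OF Y x]
    by (intro prob_space_integral_diff_le finite_measure.integrable_const_bound[where B="?c"] AE_I2
        prob_space.finite_measure) simp_all
  then show "\<bar>\<integral>p. p (T f) \<partial>\<nu>i x\<bar> \<le> ?c" by simp
qed

theorem lemma2p24:
  fixes \<Omega> :: "(real ^ 'n) set" and \<mu> :: "(real ^ 'n) measure"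
    and A B \<Gamma> :: "(real ^ 'd \<Rightarrow> real) set"
    and v :: "nat \<Rightarrow> real ^ 'n \<Rightarrow> real ^ 'd"
    and \<nu> \<eta> :: "real ^ 'n \<Rightarrow> (real ^ 'd) measure"
    and \<Lambda>\<^sub>\<nu> \<Lambda>\<^sub>\<eta> :: "(real ^ 'n) measure"
    and \<nu>i \<eta>i :: "real ^ 'n \<Rightarrow> ((real ^ 'd \<Rightarrow> real) \<Rightarrow> real) measure"
  assumes "open \<Omega>" and "bounded \<Omega>" and "borel_measure_on \<Omega> \<mu>"
    and "G1_subalgebra A" and "G1_separable A" and "separates_points_closed A"
    and "G1_subalgebra B" and "G1_separable B" and "separates_points_closed B"
    and "\<Gamma> = A \<inter> B"
    and "young_converges \<Omega> \<mu> A v \<nu> \<Lambda>\<^sub>\<nu> \<nu>i"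
    and "young_converges \<Omega> \<mu> B v \<eta> \<Lambda>\<^sub>\<eta> \<eta>i"
  shows "\<Lambda>\<^sub>\<nu> = \<Lambda>\<^sub>\<eta> \<and> (AE x in \<Lambda>\<^sub>\<nu>. proj_K \<Gamma> (\<nu>i x) = proj_K \<Gamma> (\<eta>i x))"
proof -
  note \<mu> = assms(3) and Y = assms(11) and Y' = assms(12)
  have AG: "A \<subseteq> G1" and BG: "B \<subseteq> G1" and \<Gamma>A: "\<Gamma> \<subseteq> A" and \<Gamma>B: "\<Gamma> \<subseteq> B"
    using assms(4,7,10) by (auto simp: G1_subalgebra_def)
  have alg: "G1_subalgebra \<Gamma>"
    unfolding assms(10) using assms(4,7) by (rule G1_subalgebra_Int)
  obtain D where D: "D \<subseteq> \<Gamma>" "countable D"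
    and dense: "\<And>f \<epsilon>. f \<in> \<Gamma> \<Longrightarrow> \<epsilon> > 0 \<Longrightarrow> \<exists>g\<in>D. G1_norm (\<lambda>z. f z - g z) < \<epsilon>"
    using G1_separable_subset[OF assms(5) AG \<Gamma>A] unfolding G1_separable_def by blast
  have \<Lambda>: "\<Lambda>\<^sub>\<nu> = \<Lambda>\<^sub>\<eta>"
    by (rule young_concentration_measure_eq[OF Y AG assms(6) Y' BG assms(9) \<mu>])
  \<comment> \<open>One null set for each \<open>f\<close>. Since \<open>f\<close> lies in both
    algebras, its coordinate function is its continuous extension on either side, and the fact
    \<open>\<Lambda>\<close> puts both families over one base measure.\<close>
  have coord: "AE x in \<Lambda>\<^sub>\<nu>. (\<integral>p. p (T f) \<partial>\<nu>i x) = (\<integral>p. p (T f) \<partial>\<eta>i x)" if "f \<in> D" for f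
  proof (rule AE_eq_if_continuous_moments_eq[OF closed_closure young_convergesD(3)[OF Y]])
    have f: "f \<in> A" "f \<in> B" "f \<in> G1" using that D \<Gamma>A \<Gamma>B AG by blast+
    show "(\<lambda>x. \<integral>p. p (T f) \<partial>\<nu>i x) \<in> borel_measurable (completion \<Lambda>\<^sub>\<nu>)"
      by (rule young_coord_integral(1)[OF Y f(1)])
    show "(\<lambda>x. \<integral>p. p (T f) \<partial>\<eta>i x) \<in> borel_measurable (completion \<Lambda>\<^sub>\<nu>)"
      unfolding \<Lambda> by (rule young_coord_integral(1)[OF Y' f(2)])
    show "(\<integral>x. \<phi> x * (\<integral>p. p (T f) \<partial>\<nu>i x) \<partial>completion \<Lambda>\<^sub>\<nu>) = (\<integral>x. \<phi> x * (\<integral>p. p (T f) \<partial>\<eta>i x) \<partial>completion \<Lambda>\<^sub>\<nu>)"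
      if "continuous_on UNIV \<phi>" "bounded (range \<phi>)" for \<phi>
      using young_concentration_integral_eq[OF Y AG assms(6) Y' BG assms(9) \<mu> f(3)
          extension_to_K_coord[OF AG f(1)] extension_to_K_coord[OF BG f(2)] that]
      unfolding \<Lambda> .
  qed (use young_coord_integral(2)[OF Y] young_coord_integral(2)[OF Y'] that D \<Gamma>A \<Gamma>B in blast)+
  \<comment> \<open>The null sets are united before \<open>x\<close> is fixed; the passage from
    \<open>D\<close> to all of \<open>\<Gamma>\<close> then happens at a single
    \<open>x\<close>.\<close>
  have "AE x in \<Lambda>\<^sub>\<nu>. \<forall>f\<in>D. (\<integral>p. p (T f) \<partial>\<nu>i x) = (\<integral>p. p (T f) \<partial>\<eta>i x)"
    using coord by (rule AE_ball_countable'[OF _ D(2)])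
  then have "AE x in \<Lambda>\<^sub>\<nu>. proj_K \<Gamma> (\<nu>i x) = proj_K \<Gamma> (\<eta>i x)"
    using AE_space
  proof eventually_elim
    case (elim x)
    then have x: "x \<in> closure \<Omega>"
      using space_borel_measure_on[OF young_convergesD(3)[OF Y]] by simp
    show ?case
    proof (rule borel_of_K_measure_eqI[OF alg D dense])
      show "prob_space (proj_K \<Gamma> (\<nu>i x))" "prob_space (proj_K \<Gamma> (\<eta>i x))"
        by (rule proj_K_prob[OF \<Gamma>A AG young_space(2,1)[OF Y x]]
            proj_K_prob[OF \<Gamma>B BG young_space(2,1)[OF Y' x]])+
      show "(\<integral>w. w (T f) \<partial>proj_K \<Gamma> (\<nu>i x)) = (\<integral>w. w (T f) \<partial>proj_K \<Gamma> (\<eta>i x))" if "f \<in> D" for f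
        using that elim(1) D(1) integral_proj_K[OF \<Gamma>A AG young_space(2)[OF Y x], of f]
          integral_proj_K[OF \<Gamma>B BG young_space(2)[OF Y' x], of f] by auto
    qed (simp_all add: sets_proj_K)
  qed
  with \<Lambda> show ?thesis by blast
qed

end
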